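(* Let $\mathcal{P}$ be the subalgebra of $(\mathcal{F},\star)$ generated by the characteristic functions $\mathbf{1}_{K_u}$ of the cones $K_u$, $u$ ranging over packed words. The linear map $\alpha:\mathcal{P}\to\mathbf{WQSym}$ defined by $$\mathbf{1}_{K_u}\mapsto(-1)^{\max(u)}\mathbf{M}_u$$ is an isomorphism of algebras. That is, if the product in $\mathbf{WQSym}$ is given by $\mathbf{M}_u\mathbf{M}_v=\sum_w c_{uv}^w\mathbf{M}_w$, then the characteristic function of the Cartesian product $K_u\times K_v$ is $$\mathbf{1}_{K_u\times K_v}=\sum_w(-1)^{\max(u)+\max(v)-\max(w)}\,c_{uv}^w\,\mathbf{1}_{K_w}.$$
   Context: Packed words: a word $u$ over the positive integers is packed if the set of its letters is $\{1,\dots,r\}$ for some $r=\max(u)$ (the empty word is packed, with $\max=0$). For any word $w$ over a totally ordered alphabet with distinct letters $b_1<\dots<b_r$, $\mathrm{pack}(w)$ is obtained by replacing each $b_i$ by $i$. $\mathbf{WQSym}$ (word quasi-symmetric functions, here over $\mathbb{R}$): for an infinite totally ordered alphabet $A=\{a_1<a_2<\dots\}$ of noncommuting variables, $\mathbf{M}_u=\sum_{\mathrm{pack}(w)=u}w$ (sum over words $w$ over $A$); $\mathbf{WQSym}$ is the linear span of the $\mathbf{M}_u$, which form a basis, inside the algebra of noncommutative formal series of finite degree. Its product is $\mathbf{M}_{u}\mathbf{M}_{v}=\sum_{w}\mathbf{M}_w$, over packed words $w=w'w''$ (concatenation) with $\mathrm{pack}(w')=u$, $\mathrm{pack}(w'')=v$.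 Cones: a packed word $u$ of length $n$ with $\max(u)=r$ encodes the set composition $(B_1,\dots,B_r)$ of $\{1,\dots,n\}$, where $B_k$ is the set of positions of the letter $k$ in $u$. $K_u\subset\mathbb{R}^n$ is the polyhedral cone defined by the inequalities $\sum_{j=1}^k\sum_{i\in B_j}x_i\ge0$ for $k=1,\dots,r$. $\mathcal{F}=\bigoplus_{n\ge0}\mathcal{F}_n$, where $\mathcal{F}_n$ is the space of measurable functions $\mathbb{R}^n\to\mathbb{R}$ modulo equality almost everywhere, with the associative product $(f\star g)(x_1,\dots,x_{m+n})=f(x_1,\dots,x_m)\,g(x_{m+1},\dots,x_{m+n})$ for $f\in\mathcal{F}_m$, $g\in\mathcal{F}_n$. *)

theory Defs
  imports "HOL-Analysis.Analysis"
begin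

definition subalgebra :: "'a::real_algebra_1 set \<Rightarrow> bool" where
  "subalgebra S \<longleftrightarrow> subspace S \<and> 1 \<in> S \<and> (\<forall>x\<in>S. \<forall>y\<in>S. x * y \<in> S)"

definition generated_subalgebra :: "'a::real_algebra_1 set \<Rightarrow> 'a set" where
  "generated_subalgebra X = subalgebra hull X"

definition linear_map_on :: "'a::real_vector set \<Rightarrow> 'b::real_vector set \<Rightarrow> ('a \<Rightarrow> 'b) \<Rightarrow> bool" where
  "linear_map_on A B f \<longleftrightarrow> f ` A \<subseteq> B \<and>
     (\<forall>x\<in>A. \<forall>y\<in>A. f (x + y) = f x + f y) \<and> (\<forall>c. \<forall>x\<in>A. f (c *\<^sub>R x) = c *\<^sub>R f x)"

definition algebra_iso_on :: "'a::real_algebra_1 set \<Rightarrow> 'b::real_algebra_1 set \<Rightarrow> ('a \<Rightarrow> 'b) \<Rightarrow> bool" where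
  "algebra_iso_on A B f \<longleftrightarrow> linear_map_on A B f \<and> bij_betw f A B \<and>
     f 1 = 1 \<and> (\<forall>x\<in>A. \<forall>y\<in>A. f (x * y) = f x * f y)"


definition max_letter :: "nat list \<Rightarrow> nat" where
  "max_letter u = (if u = [] then 0 else Max (set u))"

definition packed :: "nat list \<Rightarrow> bool" where
  "packed u \<longleftrightarrow> (\<exists>r. set u = {1..r})"

definition pack :: "'a::linorder list \<Rightarrow> nat list" where
  "pack w = map (\<lambda>b. card {c \<in> set w. c \<le> b}) w"

lemma length_pack [simp]: "length (pack w) = length w"
  by (simp add: pack_def)

lemma pack_map:
  fixes f :: "'a::linorder \<Rightarrow> 'b::linorder"
  assumes "strict_mono_on (set w) f"
  shows "pack (map f w) = pack w"
proof -
  have inj: "inj_on f (set w)"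
    using assms strict_mono_on_imp_inj_on by blast
  have "card {c \<in> f ` set w. c \<le> f b} = card {c \<in> set w. c \<le> b}" if b: "b \<in> set w" for b
  proof -
    have "{c \<in> f ` set w. c \<le> f b} = f ` {c \<in> set w. c \<le> b}"
      using assms b by (auto simp: strict_mono_on_leD image_iff)
        (metis linorder_not_le strict_mono_on_def)+
    then show ?thesis
      using inj by (metis (no_types, lifting) card_image inj_on_subset mem_Collect_eq subsetI)
  qed
  then show ?thesis by (simp add: pack_def)
qed

lemma strict_mono_on_rank:
  fixes w :: "'a::linorder list"
  shows "strict_mono_on (set w) (\<lambda>b. card {c \<in> set w. c \<le> b})"
proof (rule strict_mono_onI)
  fix a b assume "a \<in> set w" "b \<in> set w" "a < b"
  then have "{c \<in> set w. c \<le> a} \<subset> {c \<in> set w. c \<le> b}"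
    by (auto simp: psubset_eq set_eq_iff intro!: exI[of _ b])
  then show "card {c \<in> set w. c \<le> a} < card {c \<in> set w. c \<le> b}"
    by (intro psubset_card_mono) auto
qed

lemma pack_take_pack: "pack (take n (pack w)) = pack (take n w)"
proof -
  have "take n (pack w) = map (\<lambda>b. card {c \<in> set w. c \<le> b}) (take n w)"
    by (simp add: pack_def take_map)
  then show ?thesis
    using strict_mono_on_rank[of w] set_take_subset[of n w]
    by (metis (no_types, lifting) pack_map monotone_on_subset)
qed

lemma pack_drop_pack: "pack (drop n (pack w)) = pack (drop n w)"
proof -
  have "drop n (pack w) = map (\<lambda>b. card {c \<in> set w. c \<le> b}) (drop n w)"
    by (simp add: pack_def drop_map)
  then show ?thesis
    using strict_mono_on_rank[of w] set_drop_subset[of n w]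
    by (metis (no_types, lifting) pack_map monotone_on_subset)
qed

lemma packed_pack: "packed (pack w)"
proof -
  let ?r = "\<lambda>b. card {c \<in> set w. c \<le> b}"
  have inj: "inj_on ?r (set w)"
    using strict_mono_on_rank strict_mono_on_imp_inj_on by blast
  have sub: "?r ` set w \<subseteq> {1..card (set w)}"
  proof
    fix y assume "y \<in> ?r ` set w"
    then obtain b where b: "b \<in> set w" "y = ?r b" by blast
    have "{c \<in> set w. c \<le> b} \<noteq> {}" using b by blast
    then have "0 < y" using b by (simp add: card_gt_0_iff)
    moreover have "y \<le> card (set w)" using b by (auto intro: card_mono)
    ultimately show "y \<in> {1..card (set w)}" by simp
  qed
  have "?r ` set w = {1..card (set w)}"
    by (rule card_subset_eq) (use sub inj in \<open>auto simp: card_image\<close>)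
  then show ?thesis by (auto simp: packed_def pack_def)
qed

lemma finite_packed_length: "finite {w. packed w \<and> length w = n}"
proof -
  have "{w. packed w \<and> length w = n} \<subseteq> {w. set w \<subseteq> {..n} \<and> length w = n}"
  proof clarsimp
    fix w x assume "packed w" "x \<in> set w"
    then obtain r where r: "set w = {1..r}" by (auto simp: packed_def)
    then show "x \<le> length w" using card_length[of w] \<open>x \<in> set w\<close> by simp
  qed
  then show ?thesis
    using finite_lists_length_eq[of "{..n}" n] finite_subset by blast
qed


text \<open>
  The letter \<open>a\<^sub>i\<^sub>+\<^sub>1\<close> of the ordered alphabet is encoded by the natural number \<open>i\<close>, so a series is
  the function sending a word over \<^typ>\<open>nat\<close> to its coefficient. We use the algebra of all
  such series; those of finite degree form a subalgebra, and \<open>WQSym\<close> lies in it.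
\<close>

typedef ncseries = "UNIV :: (nat list \<Rightarrow> real) set"
  morphisms nccoeff Abs_ncseries ..

setup_lifting type_definition_ncseries

lemma sum_triple_splits:
  fixes F :: "nat \<Rightarrow> nat \<Rightarrow> nat \<Rightarrow> 'a::comm_monoid_add"
  shows "(\<Sum>k\<le>n. \<Sum>j\<le>k. F j (k - j) (n - k)) = (\<Sum>j\<le>n. \<Sum>i\<le>n - j. F j i (n - j - i))"
proof -
  have "(\<Sum>k\<le>n. \<Sum>j\<le>k. F j (k - j) (n - k)) = (\<Sum>(k, j)\<in>Sigma {..n} (\<lambda>k. {..k}). F j (k - j) (n - k))"
    by (simp add: sum.Sigma)
  also have "\<dots> = (\<Sum>(j, i)\<in>Sigma {..n} (\<lambda>j. {..n - j}). F j i (n - j - i))"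
    by (rule sum.reindex_bij_witness[of _ "\<lambda>(j, i). (j + i, j)" "\<lambda>(k, j). (j, k - j)"]) auto
  also have "\<dots> = (\<Sum>j\<le>n. \<Sum>i\<le>n - j. F j i (n - j - i))"
    by (simp add: sum.Sigma)
  finally show ?thesis .
qed

instantiation ncseries :: real_algebra_1
begin

lift_definition zero_ncseries :: ncseries is "\<lambda>_. 0" .
lift_definition one_ncseries :: ncseries is "\<lambda>w. if w = [] then 1 else 0" .
lift_definition plus_ncseries :: "ncseries \<Rightarrow> ncseries \<Rightarrow> ncseries" is "\<lambda>f g w. f w + g w" .
lift_definition minus_ncseries :: "ncseries \<Rightarrow> ncseries \<Rightarrow> ncseries" is "\<lambda>f g w. f w - g w" .
lift_definition uminus_ncseries :: "ncseries \<Rightarrow> ncseries" is "\<lambda>f w. - f w" .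
lift_definition scaleR_ncseries :: "real \<Rightarrow> ncseries \<Rightarrow> ncseries" is "\<lambda>c f w. c * f w" .
lift_definition times_ncseries :: "ncseries \<Rightarrow> ncseries \<Rightarrow> ncseries"
  is "\<lambda>f g w. \<Sum>k\<le>length w. f (take k w) * g (drop k w)" .

instance
proof
  fix a b c :: ncseries and r s :: real
  show "a + b + c = a + (b + c)" by transfer (auto simp: algebra_simps)
  show "a + b = b + a" by transfer (auto simp: algebra_simps)
  show "0 + a = a" by transfer auto
  show "- a + a = 0" by transfer auto
  show "a - b = a + - b" by transfer auto
  show "r *\<^sub>R (a + b) = r *\<^sub>R a + r *\<^sub>R b" by transfer (auto simp: algebra_simps)
  show "(r + s) *\<^sub>R a = r *\<^sub>R a + s *\<^sub>R a" by transfer (auto simp: algebra_simps)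
  show "r *\<^sub>R s *\<^sub>R a = (r * s) *\<^sub>R a" by transfer (auto simp: algebra_simps)
  show "1 *\<^sub>R a = a" by transfer auto
  show "a * b * c = a * (b * c)"
  proof (transfer, rule ext)
    fix a b c :: "nat list \<Rightarrow> real" and w :: "nat list"
    let ?F = "\<lambda>i j l. a (take i w) * b (take j (drop i w)) * c (drop (i + j) w)"
    have "(\<Sum>k\<le>length w. (\<Sum>j\<le>length (take k w). a (take j (take k w)) * b (drop j (take k w))) * c (drop k w))
        = (\<Sum>k\<le>length w. \<Sum>j\<le>k. ?F j (k - j) (length w - k))"
      by (auto simp: sum_distrib_right drop_take min_def intro!: sum.cong)
    also have "\<dots> = (\<Sum>j\<le>length w. \<Sum>i\<le>length w - j. ?F j i (length w - j - i))"
      by (rule sum_triple_splits)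
    also have "\<dots> = (\<Sum>k\<le>length w. a (take k w) *
        (\<Sum>j\<le>length (drop k w). b (take j (drop k w)) * c (drop j (drop k w))))"
      by (auto simp: sum_distrib_left mult.assoc add.commute intro!: sum.cong)
    finally show "(\<Sum>k\<le>length w. (\<Sum>j\<le>length (take k w). a (take j (take k w)) * b (drop j (take k w))) * c (drop k w))
      = (\<Sum>k\<le>length w. a (take k w) *
        (\<Sum>j\<le>length (drop k w). b (take j (drop k w)) * c (drop j (drop k w))))" .
  qed
  show "(a + b) * c = a * c + b * c"
    by transfer (auto simp: algebra_simps sum.distrib)
  show "a * (b + c) = a * b + a * c"
    by transfer (auto simp: algebra_simps sum.distrib)
  show "r *\<^sub>R a * b = r *\<^sub>R (a * b)"
    by transfer (auto simp: sum_distrib_left mult_ac)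
  show "a * r *\<^sub>R b = r *\<^sub>R (a * b)"
    by transfer (auto simp: sum_distrib_left mult_ac)
  show "1 * a = a"
  proof (transfer, rule ext)
    fix a :: "nat list \<Rightarrow> real" and w :: "nat list"
    have "(\<Sum>k\<le>length w. (if take k w = [] then 1 else 0) * a (drop k w))
        = (\<Sum>k\<le>length w. if k = 0 then a w else 0)"
      by (rule sum.cong) auto
    then show "(\<Sum>k\<le>length w. (if take k w = [] then 1 else 0) * a (drop k w)) = a w" by simp
  qed
  show "a * 1 = a"
  proof (transfer, rule ext)
    fix a :: "nat list \<Rightarrow> real" and w :: "nat list"
    have "(\<Sum>k\<le>length w. a (take k w) * (if drop k w = [] then 1 else 0))
        = (\<Sum>k\<le>length w. if k = length w then a w else 0)"
      by (rule sum.cong) auto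
    then show "(\<Sum>k\<le>length w. a (take k w) * (if drop k w = [] then 1 else 0)) = a w" by simp
  qed
  show "(0::ncseries) \<noteq> 1" by transfer (metis zero_neq_one)
qed

end

lift_definition wqs_M :: "nat list \<Rightarrow> ncseries" is "\<lambda>u w. if pack w = u then 1 else 0" .

definition WQSym :: "ncseries set" where
  "WQSym = span (wqs_M ` {u. packed u})"

lemma nccoeff_sum: "nccoeff (sum f A) w = (\<Sum>x\<in>A. nccoeff (f x) w)"
  by (induction A rule: infinite_finite_induct) (auto simp: zero_ncseries.rep_eq plus_ncseries.rep_eq)

lemma wqs_M_mult:
  "wqs_M u * wqs_M v = sum wqs_M {w. packed w \<and> (\<exists>w' w''. w = w' @ w'' \<and> pack w' = u \<and> pack w'' = v)}"
    (is "_ = sum wqs_M ?S")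
proof -
  have S: "w \<in> ?S \<longleftrightarrow> packed w \<and> length w = length u + length v \<and>
      pack (take (length u) w) = u \<and> pack (drop (length u) w) = v" for w
  proof
    assume "w \<in> ?S"
    then obtain w' w'' where *: "packed w" "w = w' @ w''" "pack w' = u" "pack w'' = v" by blast
    then have "length w' = length u" "length w'' = length v" by auto
    with * show "packed w \<and> length w = length u + length v \<and>
      pack (take (length u) w) = u \<and> pack (drop (length u) w) = v" by simp
  next
    assume *: "packed w \<and> length w = length u + length v \<and>
      pack (take (length u) w) = u \<and> pack (drop (length u) w) = v"
    have "w = take (length u) w @ drop (length u) w" by simp
    with * show "w \<in> ?S" by blast
  qed
  have fin: "finite ?S"
    by (rule finite_subset[OF _ finite_packed_length[of "length u + length v"]]) (use S in blast)
  have "nccoeff (wqs_M u * wqs_M v) w = nccoeff (sum wqs_M ?S) w" for w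
  proof -
    let ?P = "length w = length u + length v \<and> pack (take (length u) w) = u \<and> pack (drop (length u) w) = v"
    have ind: "(if A then 1 else 0) * (if B then 1 else 0) = (if A \<and> B then 1 else (0::real))"
      "(if A then (if B then 1 else 0) else 0) = (if A \<and> B then 1 else (0::real))" for A B
      by auto
    have *: "k = length u \<and> length w = length u + length v"
      if "k \<le> length w" "pack (take k w) = u" "pack (drop k w) = v" for k
      using that arg_cong[OF that(2), of length] arg_cong[OF that(3), of length] by auto
    have "nccoeff (wqs_M u * wqs_M v) w =
      (\<Sum>k\<le>length w. (if pack (take k w) = u then 1 else 0) * (if pack (drop k w) = v then 1 else 0))"
      by (simp add: times_ncseries.rep_eq wqs_M.rep_eq)
    also have "\<dots> = (\<Sum>k\<le>length w. if k = length u then (if ?P then 1 else 0) else 0)"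
    proof (rule sum.cong)
      fix k assume "k \<in> {..length w}"
      then have k: "pack (take k w) = u \<and> pack (drop k w) = v \<longleftrightarrow> k = length u \<and> ?P"
        using *[of k] by (metis atMost_iff)
      show "(if pack (take k w) = u then 1 else 0) * (if pack (drop k w) = v then 1 else 0)
          = (if k = length u then (if ?P then 1 else 0) else (0::real))"
        unfolding ind(1) ind(2) k ..
    qed simp
    also have "\<dots> = (if ?P then 1 else 0)"
    proof -
      have "(\<Sum>k\<le>length w. if k = length u then (if Q then 1 else 0) else 0) = (if Q then 1 else (0::real))"
        if "Q \<Longrightarrow> length u \<le> length w" for Q
        using that by simp
      from this[of ?P] show ?thesis by linarith
    qed
    also have "\<dots> = (if pack w \<in> ?S then 1 else 0)"
      unfolding S by (simp only: packed_pack pack_take_pack pack_drop_pack length_pack simp_thms)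
    also have "\<dots> = nccoeff (sum wqs_M ?S) w"
      using fin by (simp add: nccoeff_sum wqs_M.rep_eq)
    finally show ?thesis .
  qed
  then have "nccoeff (wqs_M u * wqs_M v) = nccoeff (sum wqs_M ?S)" by (rule ext)
  then show ?thesis by (simp only: nccoeff_inject)
qed


text \<open>
  \<open>\<real>\<^sup>n\<close> consists of the extensional functions on \<^term>\<open>{..<n}\<close>, the coordinate \<open>x\<^sub>i\<^sub>+\<^sub>1\<close> being
  \<open>x i\<close>; in particular \<open>\<real>\<^sup>0\<close> is a single point of measure 1. Modulo null sets it makes no
  difference whether functions are required to be Borel or Lebesgue measurable.
\<close>

definition lebn :: "nat \<Rightarrow> (nat \<Rightarrow> real) measure" where
  "lebn n = (\<Pi>\<^sub>M i\<in>{..<n}. lborel)"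

definition front_coords :: "nat \<Rightarrow> (nat \<Rightarrow> real) \<Rightarrow> nat \<Rightarrow> real" where
  "front_coords m x = (\<lambda>i\<in>{..<m}. x i)"

definition back_coords :: "nat \<Rightarrow> nat \<Rightarrow> (nat \<Rightarrow> real) \<Rightarrow> nat \<Rightarrow> real" where
  "back_coords m n x = (\<lambda>i\<in>{..<n}. x (m + i))"

text \<open>
  A representative of an element of the direct sum is a family of measurable functions, one in
  each degree, all but finitely many of them vanishing almost everywhere.
\<close>

definition graded_fun :: "(nat \<Rightarrow> (nat \<Rightarrow> real) \<Rightarrow> real) \<Rightarrow> bool" where
  "graded_fun f \<longleftrightarrow> (\<forall>n. f n \<in> borel_measurable (lebn n)) \<and>
     finite {n. \<not> (AE x in lebn n. f n x = 0)}"

definition graded_rel ::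
  "(nat \<Rightarrow> (nat \<Rightarrow> real) \<Rightarrow> real) \<Rightarrow> (nat \<Rightarrow> (nat \<Rightarrow> real) \<Rightarrow> real) \<Rightarrow> bool" where
  "graded_rel f g \<longleftrightarrow> graded_fun f \<and> graded_fun g \<and> (\<forall>n. AE x in lebn n. f n x = g n x)"

definition star ::
  "(nat \<Rightarrow> (nat \<Rightarrow> real) \<Rightarrow> real) \<Rightarrow> (nat \<Rightarrow> (nat \<Rightarrow> real) \<Rightarrow> real) \<Rightarrow> nat \<Rightarrow> (nat \<Rightarrow> real) \<Rightarrow> real" where
  "star f g n x = (\<Sum>k\<le>n. f k (front_coords k x) * g (n - k) (back_coords k (n - k) x))"

lemma space_lebn: "space (lebn n) = {..<n} \<rightarrow>\<^sub>E UNIV"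
  by (simp add: lebn_def space_PiM)

interpretation lebp: product_sigma_finite "\<lambda>_::nat. lborel :: real measure"
  by standard

lemma sigma_finite_lebn: "sigma_finite_measure (lebn n)"
  unfolding lebn_def by (rule lebp.sigma_finite) simp

lemma measurable_lebn_component [measurable]: "i < n \<Longrightarrow> (\<lambda>x. x i) \<in> borel_measurable (lebn n)"
  unfolding lebn_def using measurable_component_singleton[of i "{..<n}" "\<lambda>_. lborel::real measure"] by simp

lemma measurable_into_lebn:
  assumes "\<And>i. i < n \<Longrightarrow> (\<lambda>x. h x i) \<in> borel_measurable N"
  shows "(\<lambda>x. \<lambda>i\<in>{..<n}. h x i) \<in> measurable N (lebn n)"
  unfolding lebn_def using assms by (intro measurable_restrict) simp

lemma measurable_front: "k \<le> n \<Longrightarrow> front_coords k \<in> measurable (lebn n) (lebn k)"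
  unfolding front_coords_def by (rule measurable_into_lebn) (rule measurable_lebn_component, simp)

lemma measurable_back: "k + m \<le> n \<Longrightarrow> back_coords k m \<in> measurable (lebn n) (lebn m)"
  unfolding back_coords_def by (rule measurable_into_lebn) (rule measurable_lebn_component, simp)

definition join :: "nat \<Rightarrow> nat \<Rightarrow> (nat \<Rightarrow> real) \<times> (nat \<Rightarrow> real) \<Rightarrow> nat \<Rightarrow> real" where
  "join m n = (\<lambda>(x, y). \<lambda>i\<in>{..<m + n}. if i < m then x i else y (i - m))"

lemma measurable_join: "join m n \<in> measurable (lebn m \<Otimes>\<^sub>M lebn n) (lebn (m + n))"
  unfolding join_def case_prod_beta
proof (rule measurable_into_lebn)
  fix i assume i: "i < m + n"
  show "(\<lambda>p. if i < m then fst p i else snd p (i - m)) \<in> borel_measurable (lebn m \<Otimes>\<^sub>M lebn n)"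
  proof (cases "i < m")
    case True
    then show ?thesis
      using measurable_compose[OF measurable_fst measurable_lebn_component[OF True]] by simp
  next
    case False
    then have "i - m < n" using i by simp
    with False show ?thesis
      using measurable_compose[OF measurable_snd measurable_lebn_component[of "i - m" n]] by simp
  qed
qed

lemma front_join: "x \<in> space (lebn m) \<Longrightarrow> front_coords m (join m n (x, y)) = x"
  by (auto simp: front_coords_def join_def space_lebn fun_eq_iff PiE_def extensional_def)

lemma back_join: "y \<in> space (lebn n) \<Longrightarrow> back_coords m n (join m n (x, y)) = y"
  by (auto simp: back_coords_def join_def space_lebn fun_eq_iff PiE_def extensional_def)

lemma distr_join: "distr (lebn m \<Otimes>\<^sub>M lebn n) (lebn (m + n)) (join m n) = lebn (m + n)"
proof -
  interpret Y: sigma_finite_measure "lebn n" by (rule sigma_finite_lebn)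
  have "distr (lebn m \<Otimes>\<^sub>M lebn n) (lebn (m + n)) (join m n) = PiM {..<m + n} (\<lambda>_. lborel)"
  proof (rule lebp.PiM_eqI)
    fix A :: "nat \<Rightarrow> real set" assume A: "\<And>i. i \<in> {..<m + n} \<Longrightarrow> A i \<in> sets lborel"
    let ?B = "\<lambda>i. A (m + i)"
    have pre: "join m n -` Pi\<^sub>E {..<m + n} A \<inter> space (lebn m \<Otimes>\<^sub>M lebn n) = Pi\<^sub>E {..<m} A \<times> Pi\<^sub>E {..<n} ?B"
    proof (intro set_eqI iffI)
      fix p assume p: "p \<in> join m n -` Pi\<^sub>E {..<m + n} A \<inter> space (lebn m \<Otimes>\<^sub>M lebn n)"
      obtain x y where xy: "p = (x, y)" by (cases p)
      have sp: "x \<in> {..<m} \<rightarrow>\<^sub>E UNIV" "y \<in> {..<n} \<rightarrow>\<^sub>E UNIV"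
        and j: "\<And>i. i < m + n \<Longrightarrow> join m n (x, y) i \<in> A i"
        using p xy by (auto simp: space_pair_measure space_lebn)
      have "x i \<in> A i" if "i < m" for i using j[of i] that by (simp add: join_def)
      moreover have "y i \<in> ?B i" if "i < n" for i using j[of "m + i"] that by (simp add: join_def)
      ultimately show "p \<in> Pi\<^sub>E {..<m} A \<times> Pi\<^sub>E {..<n} ?B" using sp xy by (auto simp: PiE_iff)
    next
      fix p assume p: "p \<in> Pi\<^sub>E {..<m} A \<times> Pi\<^sub>E {..<n} ?B"
      obtain x y where xy: "p = (x, y)" by (cases p)
      have "y (i - m) \<in> A i" if "\<not> i < m" "i < m + n" for i
      proof -
        have "y (i - m) \<in> ?B (i - m)" using p xy that by (intro PiE_mem[of y "{..<n}" ?B]) auto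
        then show ?thesis using that by simp
      qed
      then show "p \<in> join m n -` Pi\<^sub>E {..<m + n} A \<inter> space (lebn m \<Otimes>\<^sub>M lebn n)"
        using p xy by (auto simp: join_def space_pair_measure space_lebn PiE_iff)
    qed
    have sA: "Pi\<^sub>E {..<m} A \<in> sets (lebn m)" and sB: "Pi\<^sub>E {..<n} ?B \<in> sets (lebn n)"
      and sAB: "Pi\<^sub>E {..<m + n} A \<in> sets (lebn (m + n))"
      unfolding lebn_def using A by (auto intro!: sets_PiM_I_finite)
    have "emeasure (distr (lebn m \<Otimes>\<^sub>M lebn n) (lebn (m + n)) (join m n)) (Pi\<^sub>E {..<m + n} A)
        = emeasure (lebn m) (Pi\<^sub>E {..<m} A) * emeasure (lebn n) (Pi\<^sub>E {..<n} ?B)"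
      by (simp add: emeasure_distr measurable_join sAB pre Y.emeasure_pair_measure_Times sA sB)
    also have "\<dots> = (\<Prod>i<m. emeasure lborel (A i)) * (\<Prod>i<n. emeasure lborel (A (m + i)))"
      unfolding lebn_def
      by (subst (1 2) lebp.emeasure_PiM) (use A in auto)
    also have "\<dots> = (\<Prod>i\<in>{..<m + n}. emeasure lborel (A i))"
      by (induction n) (simp_all add: mult.assoc flip: mult.assoc)
    finally show "emeasure (distr (lebn m \<Otimes>\<^sub>M lebn n) (lebn (m + n)) (join m n)) (Pi\<^sub>E {..<m + n} A)
        = (\<Prod>i\<in>{..<m + n}. emeasure lborel (A i))" .
  qed (simp_all add: lebn_def)
  then show ?thesis by (simp add: lebn_def)
qed

lemma AE_front:
  assumes "AE x in lebn m. P x"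
  shows "AE x in lebn (m + n). P (front_coords m x)"
proof -
  interpret Y: sigma_finite_measure "lebn n" by (rule sigma_finite_lebn)
  obtain N where N: "{x \<in> space (lebn m). \<not> P x} \<subseteq> N" "emeasure (lebn m) N = 0" "N \<in> sets (lebn m)"
    using assms by (auto elim: AE_E)
  let ?N = "front_coords m -` N \<inter> space (lebn (m + n))"
  have m: "front_coords m \<in> measurable (lebn (m + n)) (lebn m)" by (rule measurable_front) simp
  have sN: "?N \<in> sets (lebn (m + n))" using m N(3) by (rule measurable_sets)
  have pre: "join m n -` ?N \<inter> space (lebn m \<Otimes>\<^sub>M lebn n) = N \<times> space (lebn n)"
    using sets.sets_into_space[OF N(3)] measurable_space[OF measurable_join[of m n]]
    by (auto simp: space_pair_measure front_join)
  have "emeasure (lebn (m + n)) ?N = emeasure (distr (lebn m \<Otimes>\<^sub>M lebn n) (lebn (m + n)) (join m n)) ?N"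
    by (simp add: distr_join)
  also have "\<dots> = emeasure (lebn m \<Otimes>\<^sub>M lebn n) (N \<times> space (lebn n))"
    by (subst emeasure_distr[OF measurable_join sN]) (simp only: pre)
  also have "\<dots> = 0" using N by (simp add: Y.emeasure_pair_measure_Times)
  finally show ?thesis
    using sN N(1) measurable_space[OF m] by (intro AE_I[of _ _ ?N]) auto
qed

lemma AE_back:
  assumes "AE x in lebn n. P x"
  shows "AE x in lebn (m + n). P (back_coords m n x)"
proof -
  interpret Y: sigma_finite_measure "lebn n" by (rule sigma_finite_lebn)
  obtain N where N: "{x \<in> space (lebn n). \<not> P x} \<subseteq> N" "emeasure (lebn n) N = 0" "N \<in> sets (lebn n)"
    using assms by (auto elim: AE_E)
  let ?N = "back_coords m n -` N \<inter> space (lebn (m + n))"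
  have m: "back_coords m n \<in> measurable (lebn (m + n)) (lebn n)" by (rule measurable_back) simp
  have sN: "?N \<in> sets (lebn (m + n))" using m N(3) by (rule measurable_sets)
  have pre: "join m n -` ?N \<inter> space (lebn m \<Otimes>\<^sub>M lebn n) = space (lebn m) \<times> N"
    using sets.sets_into_space[OF N(3)] measurable_space[OF measurable_join[of m n]]
    by (auto simp: space_pair_measure back_join)
  have "emeasure (lebn (m + n)) ?N = emeasure (distr (lebn m \<Otimes>\<^sub>M lebn n) (lebn (m + n)) (join m n)) ?N"
    by (simp add: distr_join)
  also have "\<dots> = emeasure (lebn m \<Otimes>\<^sub>M lebn n) (space (lebn m) \<times> N)"
    by (subst emeasure_distr[OF measurable_join sN]) (simp only: pre)
  also have "\<dots> = 0" using N by (simp add: Y.emeasure_pair_measure_Times)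
  finally show ?thesis
    using sN N(1) measurable_space[OF m] by (intro AE_I[of _ _ ?N]) auto
qed

lemma AE_split:
  assumes "k \<le> n" "AE x in lebn k. P x" "AE x in lebn (n - k). Q x"
  shows "AE x in lebn n. P (front_coords k x)" "AE x in lebn n. Q (back_coords k (n - k) x)"
  using AE_front[OF assms(2), of "n - k"] AE_back[OF assms(3), of k]
  unfolding le_add_diff_inverse[OF assms(1)] .

lemma graded_fun_star:
  assumes f: "graded_fun f" and g: "graded_fun g"
  shows "graded_fun (star f g)"
  unfolding graded_fun_def
proof (intro conjI allI)
  fix n
  have "(\<lambda>x. f k (front_coords k x) * g (n - k) (back_coords k (n - k) x)) \<in> borel_measurable (lebn n)" if "k \<le> n" for k
    using f g that unfolding graded_fun_def
    by (intro borel_measurable_times measurable_compose[OF measurable_front]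
        measurable_compose[OF measurable_back]) auto
  then show "star f g n \<in> borel_measurable (lebn n)"
    unfolding star_def by (intro borel_measurable_sum) auto
next
  let ?S = "\<lambda>f. {n. \<not> (AE x in lebn n. f n x = (0::real))}"
  have "?S (star f g) \<subseteq> (\<lambda>(i, j). i + j) ` (?S f \<times> ?S g)"
  proof (rule subsetI, rule ccontr)
    fix n assume n: "n \<in> ?S (star f g)" and nin: "n \<notin> (\<lambda>(i, j). i + j) ` (?S f \<times> ?S g)"
    have "AE x in lebn n. f k (front_coords k x) * g (n - k) (back_coords k (n - k) x) = 0" if k: "k \<le> n" for k
    proof -
      have "(k, n - k) \<notin> ?S f \<times> ?S g" using nin k by (force simp: image_iff)
      then consider "AE x in lebn k. f k x = 0" | "AE x in lebn (n - k). g (n - k) x = 0" by auto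
      then show ?thesis
      proof cases
        case 1
        from AE_front[OF this, of "n - k"] show ?thesis
          unfolding le_add_diff_inverse[OF k] by eventually_elim simp
      next
        case 2
        from AE_back[OF this, of k] show ?thesis
          unfolding le_add_diff_inverse[OF k] by eventually_elim simp
      qed
    qed
    then have "AE x in lebn n. \<forall>k\<in>{..n}. f k (front_coords k x) * g (n - k) (back_coords k (n - k) x) = 0"
      by (intro AE_finite_allI) auto
    then have "AE x in lebn n. star f g n x = 0"
      unfolding star_def by eventually_elim (rule sum.neutral)
    then show False using n by simp
  qed
  then show "finite (?S (star f g))"
    using f g finite_subset unfolding graded_fun_def by blast
qed

lemma graded_rel_star:
  assumes "graded_rel f f'" "graded_rel g g'"
  shows "graded_rel (star f g) (star f' g')"
  unfolding graded_rel_def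
proof (intro conjI allI)
  show "graded_fun (star f g)" "graded_fun (star f' g')"
    using assms by (auto simp: graded_rel_def graded_fun_star)
  fix n
  have "AE x in lebn n. f k (front_coords k x) * g (n - k) (back_coords k (n - k) x)
      = f' k (front_coords k x) * g' (n - k) (back_coords k (n - k) x)" if k: "k \<le> n" for k
    using AE_split(1)[of k n "\<lambda>x. f k x = f' k x" "\<lambda>x. g (n - k) x = g' (n - k) x"]
      AE_split(2)[of k n "\<lambda>x. f k x = f' k x" "\<lambda>x. g (n - k) x = g' (n - k) x"] assms k
    unfolding graded_rel_def by auto
  then have "AE x in lebn n. \<forall>k\<in>{..n}. f k (front_coords k x) * g (n - k) (back_coords k (n - k) x)
      = f' k (front_coords k x) * g' (n - k) (back_coords k (n - k) x)"
    by (intro AE_finite_allI) auto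
  then show "AE x in lebn n. star f g n x = star f' g' n x"
    by eventually_elim (simp add: star_def)
qed

lemma star_assoc: "star (star f g) h = star f (star g h)"
proof (intro ext)
  fix n x
  have e: "front_coords j (front_coords k x) = front_coords j x" "back_coords j (k - j) (front_coords k x) = back_coords j (k - j) x"
    if "j \<le> k" for j k using that by (auto simp: front_coords_def back_coords_def fun_eq_iff)
  have e2: "front_coords i (back_coords j (n - j) x) = back_coords j i x"
    "back_coords i (n - j - i) (back_coords j (n - j) x) = back_coords (j + i) (n - j - i) x"
    if "i \<le> n - j" for i j using that by (auto simp: front_coords_def back_coords_def fun_eq_iff add.assoc)
  have e3: "back_coords i (n - (j + i)) (back_coords j (n - j) x) = back_coords (j + i) (n - (j + i)) x"
    if "i \<le> n - j" for i j using e2(2)[OF that] by simp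
  let ?F = "\<lambda>j i l. f j (front_coords j x) * g i (back_coords j i x) * h l (back_coords (j + i) l x)"
  have "star (star f g) h n x = (\<Sum>k\<le>n. \<Sum>j\<le>k. ?F j (k - j) (n - k))"
    unfolding star_def by (auto simp: e sum_distrib_right intro!: sum.cong)
  also have "\<dots> = (\<Sum>j\<le>n. \<Sum>i\<le>n - j. ?F j i (n - j - i))"
    by (rule sum_triple_splits)
  also have "\<dots> = star f (star g h) n x"
    unfolding star_def by (auto simp: e2 e3 sum_distrib_left mult.assoc intro!: sum.cong)
  finally show "star (star f g) h n x = star f (star g h) n x" .
qed

lemma graded_fun_zero: "graded_fun (\<lambda>n x. 0)"
  by (simp add: graded_fun_def)

lemma graded_fun_homogeneous:
  assumes "f \<in> borel_measurable (lebn n)"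
  shows "graded_fun (\<lambda>k. if k = n then f else (\<lambda>x. 0))"
proof -
  have "{k. \<not> (AE x in lebn k. (if k = n then f else (\<lambda>x. 0)) x = 0)} \<subseteq> {n}" by auto
  then show ?thesis using assms by (auto simp: graded_fun_def intro: finite_subset)
qed

lemma graded_fun_add:
  assumes "graded_fun f" "graded_fun g"
  shows "graded_fun (\<lambda>n x. f n x + g n x)"
proof -
  have "{n. \<not> (AE x in lebn n. f n x + g n x = 0)} \<subseteq>
    {n. \<not> (AE x in lebn n. f n x = 0)} \<union> {n. \<not> (AE x in lebn n. g n x = 0)}"
  proof -
    have "AE x in lebn n. f n x + g n x = 0"
      if "AE x in lebn n. f n x = 0" "AE x in lebn n. g n x = 0" for n
      using that by eventually_elim simp
    then show ?thesis by blast
  qed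
  then show ?thesis using assms unfolding graded_fun_def
    by (auto intro: finite_subset borel_measurable_add)
qed

lemma graded_fun_scale:
  assumes "graded_fun f"
  shows "graded_fun (\<lambda>n x. c * f n x)"
proof -
  have "{n. \<not> (AE x in lebn n. c * f n x = 0)} \<subseteq> {n. \<not> (AE x in lebn n. f n x = 0)}"
    by auto
  then show ?thesis using assms unfolding graded_fun_def
    by (auto intro: finite_subset borel_measurable_times)
qed

quotient_type gradedF = "nat \<Rightarrow> (nat \<Rightarrow> real) \<Rightarrow> real" / partial: graded_rel
proof (rule part_equivpI)
  show "\<exists>f. graded_rel f f" using graded_fun_zero by (auto simp: graded_rel_def)
  show "symp graded_rel" by (auto simp: symp_def graded_rel_def eq_commute)
  show "transp graded_rel"
  proof (rule transpI)
    fix f g h assume "graded_rel f g" "graded_rel g h"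
    then have gf: "graded_fun f" "graded_fun h"
      and ae: "\<And>n. AE x in lebn n. f n x = g n x" "\<And>n. AE x in lebn n. g n x = h n x"
      by (auto simp: graded_rel_def)
    have "AE x in lebn n. f n x = h n x" for n using ae(1)[of n] ae(2)[of n] by auto
    then show "graded_rel f h" using gf by (simp add: graded_rel_def)
  qed
qed

lemma graded_relI:
  "graded_fun f \<Longrightarrow> graded_fun g \<Longrightarrow> (\<And>n x. x \<in> space (lebn n) \<Longrightarrow> f n x = g n x) \<Longrightarrow> graded_rel f g"
  by (simp add: graded_rel_def)

lemma graded_rel_imp: "graded_rel f g \<Longrightarrow> graded_fun f" "graded_rel f g \<Longrightarrow> graded_fun g"
  by (simp_all add: graded_rel_def)

instantiation gradedF :: real_algebra_1
begin

lift_definition zero_gradedF :: gradedF is "\<lambda>n x. 0"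
  by (simp add: graded_rel_def graded_fun_zero)

lift_definition one_gradedF :: gradedF is "\<lambda>n. if n = 0 then (\<lambda>x. 1) else (\<lambda>x. 0)"
  using graded_fun_homogeneous[of "\<lambda>x. 1" 0] by (simp add: graded_rel_def)

lift_definition plus_gradedF :: "gradedF \<Rightarrow> gradedF \<Rightarrow> gradedF" is "\<lambda>f g n x. f n x + g n x"
proof -
  fix f f' g g' :: "nat \<Rightarrow> (nat \<Rightarrow> real) \<Rightarrow> real"
  assume a: "graded_rel f f'" "graded_rel g g'"
  then have "AE x in lebn n. f n x + g n x = f' n x + g' n x" for n
  proof -
    from a have "AE x in lebn n. f n x = f' n x" "AE x in lebn n. g n x = g' n x"
      by (simp_all add: graded_rel_def)
    then show ?thesis by eventually_elim simp
  qed
  with a show "graded_rel (\<lambda>n x. f n x + g n x) (\<lambda>n x. f' n x + g' n x)"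
    by (simp add: graded_rel_def graded_fun_add)
qed

lift_definition scaleR_gradedF :: "real \<Rightarrow> gradedF \<Rightarrow> gradedF" is "\<lambda>c f n x. c * f n x"
proof -
  fix c :: real and f f' :: "nat \<Rightarrow> (nat \<Rightarrow> real) \<Rightarrow> real"
  assume a: "graded_rel f f'"
  then have "AE x in lebn n. c * f n x = c * f' n x" for n
  proof -
    from a have "AE x in lebn n. f n x = f' n x" by (simp add: graded_rel_def)
    then show ?thesis by eventually_elim simp
  qed
  with a show "graded_rel (\<lambda>n x. c * f n x) (\<lambda>n x. c * f' n x)"
    unfolding graded_rel_def by (simp add: graded_fun_scale)
qed

lift_definition times_gradedF :: "gradedF \<Rightarrow> gradedF \<Rightarrow> gradedF" is star
  by (rule graded_rel_star)

definition uminus_gradedF :: "gradedF \<Rightarrow> gradedF" where "uminus_gradedF f = (-1) *\<^sub>R f"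
definition minus_gradedF :: "gradedF \<Rightarrow> gradedF \<Rightarrow> gradedF" where "minus_gradedF f g = f + (-1) *\<^sub>R g"

instance
proof
  fix a b c :: gradedF and r s :: real
  note gf = graded_fun_add graded_fun_scale graded_fun_star graded_fun_zero
  show "a + b + c = a + (b + c)"
    by transfer (auto intro!: graded_relI gf dest: graded_rel_imp)
  show "a + b = b + a" by transfer (auto intro!: graded_relI gf dest: graded_rel_imp)
  show "0 + a = a" by transfer (auto intro!: graded_relI gf dest: graded_rel_imp)
  show "- a + a = 0" unfolding uminus_gradedF_def
    by transfer (auto intro!: graded_relI gf graded_fun_add[OF graded_fun_scale[of _ "-1", simplified]] dest: graded_rel_imp)
  show "a - b = a + - b" by (simp add: uminus_gradedF_def minus_gradedF_def)
  show "r *\<^sub>R (a + b) = r *\<^sub>R a + r *\<^sub>R b"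
    by transfer (rule graded_relI, auto intro!: gf simp: distrib_left dest: graded_rel_imp)
  show "(r + s) *\<^sub>R a = r *\<^sub>R a + s *\<^sub>R a"
    by transfer (rule graded_relI, auto intro!: gf simp: distrib_right dest: graded_rel_imp)
  show "r *\<^sub>R s *\<^sub>R a = (r * s) *\<^sub>R a"
    by transfer (rule graded_relI, auto intro!: gf simp: mult.assoc dest: graded_rel_imp)
  show "1 *\<^sub>R a = a"
    by transfer (rule graded_relI, auto intro!: gf dest: graded_rel_imp)
  show "a * b * c = a * (b * c)"
    by transfer (rule graded_relI, auto intro!: gf simp: star_assoc dest: graded_rel_imp)
  show "(a + b) * c = a * c + b * c"
    by transfer (rule graded_relI, ((intro gf; erule graded_rel_imp)+)[2], simp add: star_def sum.distrib distrib_right)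
  show "a * (b + c) = a * b + a * c"
    by transfer (rule graded_relI, ((intro gf; erule graded_rel_imp)+)[2], simp add: star_def sum.distrib distrib_left)
  show "r *\<^sub>R a * b = r *\<^sub>R (a * b)"
    by transfer (rule graded_relI, ((intro gf; erule graded_rel_imp)+)[2], simp add: star_def sum_distrib_left mult_ac)
  show "a * r *\<^sub>R b = r *\<^sub>R (a * b)"
    by transfer (rule graded_relI, ((intro gf; erule graded_rel_imp)+)[2], simp add: star_def sum_distrib_left mult_ac)
  have one: "graded_fun (\<lambda>n. if n = 0 then (\<lambda>x. 1) else (\<lambda>x. 0))"
    by (rule graded_fun_homogeneous) simp
  show "1 * a = a"
  proof (transfer, rule graded_relI)
    fix a assume a: "graded_rel a a"
    show "graded_fun (star (\<lambda>n. if n = 0 then (\<lambda>x. 1) else (\<lambda>x. 0)) a)" "graded_fun a"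
      using a one by (auto intro: gf dest: graded_rel_imp)
    fix n x assume x: "x \<in> space (lebn n)"
    have b: "back_coords 0 n x = x" using x by (auto simp: back_coords_def space_lebn PiE_def extensional_restrict[of x])
    have "star (\<lambda>n. if n = 0 then (\<lambda>x. 1) else (\<lambda>x. 0)) a n x = (\<Sum>k\<le>n. if k = 0 then a n x else 0)"
      unfolding star_def by (rule sum.cong) (auto simp: b)
    then show "star (\<lambda>n. if n = 0 then (\<lambda>x. 1) else (\<lambda>x. 0)) a n x = a n x" by simp
  qed
  show "a * 1 = a"
  proof (transfer, rule graded_relI)
    fix a assume a: "graded_rel a a"
    show "graded_fun (star a (\<lambda>n. if n = 0 then (\<lambda>x. 1) else (\<lambda>x. 0)))" "graded_fun a"
      using a one by (auto intro: gf dest: graded_rel_imp)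
    fix n x assume x: "x \<in> space (lebn n)"
    have b: "front_coords n x = x" using x by (auto simp: front_coords_def space_lebn PiE_def extensional_restrict[of x])
    have "star a (\<lambda>n. if n = 0 then (\<lambda>x. 1) else (\<lambda>x. 0)) n x = (\<Sum>k\<le>n. if k = n then a n x else 0)"
      unfolding star_def by (rule sum.cong) (auto simp: b)
    then show "star a (\<lambda>n. if n = 0 then (\<lambda>x. 1) else (\<lambda>x. 0)) n x = a n x" by simp
  qed
  show "(0::gradedF) \<noteq> 1"
  proof (transfer, rule notI)
    assume "graded_rel (\<lambda>n x. 0) (\<lambda>n. if n = 0 then (\<lambda>x. 1) else (\<lambda>x. 0))"
    then have "\<forall>n. AE x in lebn n. 0 = (if n = 0 then (\<lambda>x. 1) else (\<lambda>x. 0 :: real)) x"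
      unfolding graded_rel_def by (elim conjE)
    from spec[OF this, of 0] have "AE x in lebn 0. False" by simp
    then have "emeasure (lebn 0) (space (lebn 0)) = 0"
      by (simp add: AE_iff_null null_setsD1)
    moreover have "emeasure (lebn 0) (space (lebn 0)) = 1"
      using lebp.emeasure_PiM[of "{}" "\<lambda>_. UNIV"] by (simp add: lebn_def space_PiM)
    ultimately show False by simp
  qed
qed

end


text \<open>
  The class in degree \<open>n\<close> of the characteristic function of a measurable \<open>A \<subseteq> \<real>\<^sup>n\<close>. It is set to
  \<open>0\<close> for non-measurable \<open>A\<close>; the lemmas below show that this case does not arise for cones
  and their products.
\<close>

lift_definition char_fun :: "nat \<Rightarrow> (nat \<Rightarrow> real) set \<Rightarrow> gradedF"
  is "\<lambda>n A k. if k = n then (if A \<in> sets (lebn n) then indicator A else (\<lambda>x. 0)) else (\<lambda>x. 0)"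
proof -
  fix n and A :: "(nat \<Rightarrow> real) set"
  show "graded_rel
    (\<lambda>k. if k = n then (if A \<in> sets (lebn n) then indicator A else (\<lambda>x. 0)) else (\<lambda>x. 0))
    (\<lambda>k. if k = n then (if A \<in> sets (lebn n) then indicator A else (\<lambda>x. 0)) else (\<lambda>x. 0))"
    unfolding graded_rel_def by (intro conjI graded_fun_homogeneous) auto
qed

definition block :: "nat list \<Rightarrow> nat \<Rightarrow> nat set" where
  "block u k = {i. i < length u \<and> u ! i = k}"

definition word_cone :: "nat list \<Rightarrow> (nat \<Rightarrow> real) set" where
  "word_cone u = {x \<in> space (lebn (length u)).
     \<forall>k\<in>{1..max_letter u}. 0 \<le> (\<Sum>j=1..k. \<Sum>i\<in>block u j. x i)}"

text \<open>Cartesian product, under the identification of \<open>\<real>\<^sup>m \<times> \<real>\<^sup>n\<close> with \<open>\<real>\<^sup>m\<^sup>+\<^sup>n\<close>.\<close>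

definition cart_prod :: "nat \<Rightarrow> nat \<Rightarrow> (nat \<Rightarrow> real) set \<Rightarrow> (nat \<Rightarrow> real) set \<Rightarrow> (nat \<Rightarrow> real) set" where
  "cart_prod m n A B = {x \<in> space (lebn (m + n)). front_coords m x \<in> A \<and> back_coords m n x \<in> B}"

lemma word_cone_sets: "word_cone u \<in> sets (lebn (length u))"
proof -
  have "(\<lambda>x. \<Sum>j=1..k. \<Sum>i\<in>block u j. x i) \<in> borel_measurable (lebn (length u))" for k
    by (intro borel_measurable_sum measurable_lebn_component) (auto simp: block_def)
  note [measurable] = this
  show ?thesis unfolding word_cone_def by measurable
qed

lemma cart_prod_sets:
  assumes "A \<in> sets (lebn m)" "B \<in> sets (lebn n)"
  shows "cart_prod m n A B \<in> sets (lebn (m + n))"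
proof -
  note [measurable] = assms measurable_front[of m "m + n"] measurable_back[of m n "m + n"]
  show ?thesis unfolding cart_prod_def by measurable
qed

definition cone_char :: "nat list \<Rightarrow> gradedF" where
  "cone_char u = char_fun (length u) (word_cone u)"

definition cone_algebra :: "gradedF set" where
  "cone_algebra = generated_subalgebra (cone_char ` {u. packed u})"

end

theory Submission
  imports Defs
begin

text \<open>
  Two facts carry the theorem.

  First, the formula for \<open>1\<close> of \<open>K\<^sub>u \<times> K\<^sub>v\<close> holds at every point. Fix \<open>x\<close>, and let \<open>a\<^sub>i\<close> be the sum of the
  coordinates of \<open>x\<close> in the first \<open>i\<close> blocks of \<open>u\<close>, and \<open>b\<^sub>j\<close> the same for \<open>v\<close>. A word \<open>w\<close> occurring in
  the product of \<open>M\<^sub>u\<close> and \<open>M\<^sub>v\<close> merges the two set compositions, so it is a lattice path from \<open>(0,0)\<close> to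
  \<open>(max u, max v)\<close> with steps \<open>(1,0)\<close>, \<open>(0,1)\<close> and \<open>(1,1)\<close>, and \<open>x\<close> lies in \<open>K\<^sub>w\<close> iff \<open>a\<^sub>i + b\<^sub>j \<ge> 0\<close> at every
  lattice point \<open>(i,j)\<close> of the path. Removing the last step gives a recursion for the signed sum over
  all such paths, and an induction shows that it collapses to the condition that all \<open>a\<^sub>i\<close> and all
  \<open>b\<^sub>j\<close> are nonnegative, which describes \<open>K\<^sub>u \<times> K\<^sub>v\<close> (\<open>signed_sum_quasi_shuffles\<close>,
  \<open>indicator_cart_prod_word_cone\<close>).

  Secondly, the functions \<open>1\<close> of \<open>K\<^sub>u\<close> are linearly independent modulo null sets. Every inequality
  bounds a sum of coordinates from below, and where it fails it fails strictly, so membership in \<open>K\<^sub>u\<close>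
  does not change when the coordinates are increased a little. A linear combination that vanishes almost everywhere thus vanishes
  everywhere (\<open>AE_flag_sum_eq_0_imp\<close>). The cone \<open>K\<^sub>u\<close> is given by a chain of sets \<open>S\<close> and the
  inequalities \<open>x(S) \<ge> 0\<close>, where \<open>x(S)\<close> is the sum of \<open>x\<close> over \<open>S\<close>. In a vanishing combination choose a
  smallest set \<open>V\<close> among all chains with nonzero coefficient and cross the wall \<open>x(V) = 0\<close>. Only the
  chains through \<open>V\<close> contribute to the jump, they all start with \<open>V\<close>, and the jump is a vanishing
  combination for the shorter chains of the sets \<open>S - V\<close>. Induction on the length of the chains
  finishes the argument (\<open>flag_cones_independent\<close>).

  By the first fact the span of the \<open>1\<close> of \<open>K\<^sub>u\<close> is closed under products, so it is the algebra they
  generate; by the second they form a basis of it. The map \<open>\<alpha>\<close> therefore exists, it carries a basis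
  to a basis, and the product formula says that it is multiplicative on basis elements.
\<close>

section \<open>Signed sums over lattice paths\<close>

text \<open>
  The lattice paths from \<open>(0,0)\<close> to \<open>(r,s)\<close>: the pair \<open>(F, G)\<close> stands for the path whose step number \<open>k\<close>
  advances the first coordinate iff \<open>k \<in> F\<close> and the second iff \<open>k \<in> G\<close>. Such pairs arise directly as the
  letter sets of the two factors of a word. After \<open>k\<close> steps the path is at the point
  \<open>(card {c \<in> F. c \<le> k}, card {c \<in> G. c \<le> k})\<close>.
\<close>

definition quasi_shuffles :: "nat \<Rightarrow> nat \<Rightarrow> (nat set \<times> nat set) set" where
  "quasi_shuffles r s = {(F, G). (\<exists>t. F \<union> G = {1..t}) \<and> card F = r \<and> card G = s}"

definition path_nonneg :: "(nat \<Rightarrow> real) \<Rightarrow> (nat \<Rightarrow> real) \<Rightarrow> nat set \<times> nat set \<Rightarrow> bool" where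
  "path_nonneg a b = (\<lambda>(F, G). \<forall>k\<in>F \<union> G. 0 \<le> a (card {c \<in> F. c \<le> k}) + b (card {c \<in> G. c \<le> k}))"

lemma finite_quasi_shuffles: "finite (quasi_shuffles r s)"
proof -
  have "quasi_shuffles r s \<subseteq> Pow {1..r + s} \<times> Pow {1..r + s}"
  proof
    fix p assume "p \<in> quasi_shuffles r s"
    then obtain F G t where p: "p = (F, G)" "F \<union> G = {1..t}" "card F = r" "card G = s"
      by (auto simp: quasi_shuffles_def)
    have "t = card (F \<union> G)" using p by simp
    also have "\<dots> \<le> r + s" using card_Un_le[of F G] p by simp
    finally have "F \<union> G \<subseteq> {1..r + s}" using p by simp
    with p(1) show "p \<in> Pow {1..r + s} \<times> Pow {1..r + s}" by simp
  qed
  then show ?thesis by (rule finite_subset) simp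
qed

lemma quasi_shuffles_top:
  assumes "(F, G) \<in> quasi_shuffles r s" "t = card (F \<union> G)"
  shows "F \<union> G = {1..t}" "card F = r" "card G = s" "finite F" "finite G"
proof -
  obtain t' where t': "F \<union> G = {1..t'}" and c: "card F = r" "card G = s"
    using assms(1) by (auto simp: quasi_shuffles_def)
  show "F \<union> G = {1..t}" using t' assms(2) by simp
  show "finite F" "finite G" using t' by (metis finite_Un finite_atLeastAtMost)+
qed (use assms in \<open>auto simp: quasi_shuffles_def\<close>)

text \<open>
  The possible positions before the last step of a path that ends in \<open>(r, s)\<close>.
\<close>

definition predecessors :: "nat \<Rightarrow> nat \<Rightarrow> (nat \<times> nat) set" where
  "predecessors r s = {(r', s'). r' \<le> r \<and> r \<le> Suc r' \<and> s' \<le> s \<and> s \<le> Suc s' \<and> (r', s') \<noteq> (r, s)}"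

lemma predecessors_simps:
  "predecessors 0 0 = {}"
  "predecessors 0 (Suc s) = {(0, s)}"
  "predecessors (Suc r) 0 = {(r, 0)}"
  "predecessors (Suc r) (Suc s) = {(r, Suc s), (Suc r, s), (r, s)}"
  by (auto simp: predecessors_def)

text \<open>
  Deleting the last step \<open>Suc t\<close> is a bijection from the paths to \<open>(r, s)\<close> onto the paths to all its
  predecessors: the predecessor reached tells which coordinates the deleted step advanced.
\<close>

lemma sum_quasi_shuffles_step:
  fixes f :: "nat set \<times> nat set \<Rightarrow> real"
  assumes rs: "0 < r + s"
    and step: "\<And>F G F' G' t. \<lbrakk>F' \<union> G' = {1..t}; finite F'; finite G'; F = F' \<or> F = insert (Suc t) F'; G = G' \<or> G = insert (Suc t) G';
        F \<union> G = {1..Suc t}; card F = r; card G = s\<rbrakk> \<Longrightarrow> f (F, G) = g (F', G')"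
  shows "(\<Sum>p\<in>quasi_shuffles r s. f p) = (\<Sum>(r', s')\<in>predecessors r s. \<Sum>p\<in>quasi_shuffles r' s'. g p)"
proof -
  define top where "top = (\<lambda>(F, G). card (F \<union> G :: nat set))"
  define rem where "rem = (\<lambda>(F, G). (F - {top (F, G)}, G - {top (F, G)}))"
  define ins where "ins = (\<lambda>(F, G). (if card F < r then insert (Suc (top (F, G))) F else F,
      if card G < s then insert (Suc (top (F, G))) G else G))"
  have fin: "finite (predecessors r s)"
    by (rule finite_subset[of _ "{..r} \<times> {..s}"]) (auto simp: predecessors_def)
  have R: "\<exists>t F' G'. rem (F, G) = (F', G') \<and> F' \<union> G' = {1..t} \<and> finite F' \<and> finite G' \<and> (F = F' \<or> F = insert (Suc t) F') \<and>
      (G = G' \<or> G = insert (Suc t) G') \<and> F \<union> G = {1..Suc t} \<and> card F = r \<and> card G = s \<and>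
      (card F', card G') \<in> predecessors r s \<and> ins (F', G') = (F, G)"
    if p: "(F, G) \<in> quasi_shuffles r s" for F G
  proof -
    note q = quasi_shuffles_top[OF p refl]
    have "F \<union> G \<noteq> {}" using q rs by (metis Un_empty card.empty add_is_0 less_irrefl)
    then obtain t where t: "card (F \<union> G) = Suc t" using q
      by (metis card_0_eq finite_Un not0_implies_Suc)
    let ?F = "F - {Suc t}" and ?G = "G - {Suc t}"
    have un: "F \<union> G = {1..Suc t}" using q t by simp
    have rem: "rem (F, G) = (?F, ?G)" by (simp add: rem_def top_def t)
    have un': "?F \<union> ?G = {1..t}"
    proof -
      have "?F \<union> ?G = (F \<union> G) - {Suc t}" by blast
      then show ?thesis unfolding un by (simp add: atLeastAtMostSuc_conv)
    qed
    have c: "card ?F = (if Suc t \<in> F then r - 1 else r)" "card ?G = (if Suc t \<in> G then s - 1 else s)"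
      using q(2,3) by (simp_all add: card_Diff_singleton)
    have mem: "Suc t \<in> F \<or> Suc t \<in> G"
    proof -
      have "Suc t \<in> F \<union> G" unfolding un by simp
      then show ?thesis by blast
    qed
    have pos: "Suc t \<in> F \<Longrightarrow> 0 < r" "Suc t \<in> G \<Longrightarrow> 0 < s" using q(2-5) by (auto simp: card_gt_0_iff)
    have pre: "(card ?F, card ?G) \<in> predecessors r s"
      using mem pos unfolding c predecessors_def by auto
    have "card (?F \<union> ?G) = t" unfolding un' by simp
    then have ins: "ins (?F, ?G) = (F, G)"
      using pos c by (auto simp: ins_def top_def)
    show ?thesis
    proof (intro exI conjI)
      show "rem (F, G) = (?F, ?G)" "?F \<union> ?G = {1..t}" "F \<union> G = {1..Suc t}"
        "(card ?F, card ?G) \<in> predecessors r s" "ins (?F, ?G) = (F, G)" "card F = r" "card G = s"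
        by (fact rem un' un pre ins q)+
      show "finite ?F" "finite ?G" using q(4,5) by simp_all
      show "F = ?F \<or> F = insert (Suc t) ?F" by (cases "Suc t \<in> F") (simp_all add: insert_absorb)
      show "G = ?G \<or> G = insert (Suc t) ?G" by (cases "Suc t \<in> G") (simp_all add: insert_absorb)
    qed
  qed
  have I: "ins (F', G') \<in> quasi_shuffles r s \<and> rem (ins (F', G')) = (F', G')"
    if pre: "(r', s') \<in> predecessors r s" and p: "(F', G') \<in> quasi_shuffles r' s'" for r' s' F' G'
  proof -
    define t where "t = card (F' \<union> G')"
    note q = quasi_shuffles_top[OF p t_def]
    have n: "Suc t \<notin> F'" "Suc t \<notin> G'" using q(1) by (metis UnI1 UnI2 atLeastAtMost_iff not_less_eq_eq order_refl)+
    obtain F G where FG: "ins (F', G') = (F, G)" by (cases "ins (F', G')")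
    have F: "F = (if card F' < r then insert (Suc t) F' else F')"
      and G: "G = (if card G' < s then insert (Suc t) G' else G')"
      using FG by (auto simp: ins_def top_def t_def)
    have "card F' < r \<or> card G' < s" using pre q(2,3) by (auto simp: predecessors_def)
    then have "F \<union> G = insert (Suc t) (F' \<union> G')" unfolding F G by auto
    then have un: "F \<union> G = {1..Suc t}" by (simp add: q(1) atLeastAtMostSuc_conv)
    moreover have "card F = r" "card G = s"
      using n pre q(2-5) unfolding F G by (auto simp: predecessors_def)
    moreover have "top (F, G) = Suc t" using un by (simp add: top_def)
    moreover have "F - {Suc t} = F'" "G - {Suc t} = G'" using n unfolding F G by auto
    ultimately show ?thesis unfolding FG by (auto simp: quasi_shuffles_def rem_def)
  qed
  have "(\<Sum>p\<in>quasi_shuffles r s. f p) =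
      (\<Sum>(rs, p)\<in>Sigma (predecessors r s) (\<lambda>(r', s'). quasi_shuffles r' s'). g p)"
  proof (rule sum.reindex_bij_witness[where i = "ins \<circ> snd" and
        j = "\<lambda>p. ((card (fst (rem p)), card (snd (rem p))), rem p)"])
    fix p assume p: "p \<in> quasi_shuffles r s"
    obtain F G where FG: "p = (F, G)" by (cases p)
    obtain t F' G' where *: "rem (F, G) = (F', G')" "F' \<union> G' = {1..t}" "finite F'" "finite G'" "(F = F' \<or> F = insert (Suc t) F')"
      "(G = G' \<or> G = insert (Suc t) G')" "F \<union> G = {1..Suc t}" "card F = r" "card G = s"
      "(card F', card G') \<in> predecessors r s" "ins (F', G') = (F, G)"
      using R[OF p[unfolded FG]] by blast
    show "(ins \<circ> snd) ((card (fst (rem p)), card (snd (rem p))), rem p) = p" using * FG by simp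
    show "((card (fst (rem p)), card (snd (rem p))), rem p) \<in> Sigma (predecessors r s) (\<lambda>(r', s'). quasi_shuffles r' s')"
      using * FG by (auto simp: quasi_shuffles_def)
    show "(case ((card (fst (rem p)), card (snd (rem p))), rem p) of (rs, p) \<Rightarrow> g p) = f p"
      using step[OF *(2-9)] *(1) FG by simp
  next
    fix y assume "y \<in> Sigma (predecessors r s) (\<lambda>(r', s'). quasi_shuffles r' s')"
    then obtain r' s' F G where y: "y = ((r', s'), (F, G))" "(r', s') \<in> predecessors r s" "(F, G) \<in> quasi_shuffles r' s'"
      by auto
    show "(ins \<circ> snd) y \<in> quasi_shuffles r s" using I[OF y(2,3)] y(1) by simp
    have c: "card F = r'" "card G = s'" using y(3) by (auto simp: quasi_shuffles_def)
    show "((card (fst (rem ((ins \<circ> snd) y))), card (snd (rem ((ins \<circ> snd) y)))), rem ((ins \<circ> snd) y)) = y"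
      using I[OF y(2,3)] y(1) c by simp
  qed
  also have "\<dots> = (\<Sum>(r', s')\<in>predecessors r s. \<Sum>p\<in>quasi_shuffles r' s'. g p)"
    by (subst sum.Sigma[symmetric]) (use fin in \<open>auto simp: finite_quasi_shuffles case_prod_beta intro: sum.cong\<close>)
  finally show ?thesis .
qed

lemma card_below_top:
  assumes "F' \<subseteq> {1..t}" "F = F' \<or> F = insert (Suc t) F'"
  shows "k \<le> t \<Longrightarrow> card {c \<in> F. c \<le> k} = card {c \<in> F'. c \<le> k}"
    and "card {c \<in> F. c \<le> Suc t} = card F"
proof -
  show "card {c \<in> F. c \<le> k} = card {c \<in> F'. c \<le> k}" if "k \<le> t"
    using assms(2) that by (auto intro!: arg_cong[of _ _ card])
  have "{c \<in> F. c \<le> Suc t} = F" using assms by auto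
  then show "card {c \<in> F. c \<le> Suc t} = card F" by simp
qed

lemma path_nonneg_step:
  assumes un: "F' \<union> G' = {1..t}" "F \<union> G = {1..Suc t}"
    and F: "F = F' \<or> F = insert (Suc t) F'" and G: "G = G' \<or> G = insert (Suc t) G'"
  shows "path_nonneg a b (F, G) \<longleftrightarrow> 0 \<le> a (card F) + b (card G) \<and> path_nonneg a b (F', G')"
proof -
  have sub: "F' \<subseteq> {1..t}" "G' \<subseteq> {1..t}" using un by auto
  note c = card_below_top[OF sub(1) F] card_below_top[OF sub(2) G]
  have e: "{1..Suc t} = insert (Suc t) {1..t}" by auto
  show ?thesis
    unfolding path_nonneg_def prod.case un e ball_simps c(2,4) by (auto simp: c(1,3))
qed

text \<open>
  Let \<open>A i\<close> and \<open>B j\<close> be the truth values (\<open>0\<close> or \<open>1\<close>) of "\<open>a\<close> is nonnegative on \<open>{1..i}\<close>" and "\<open>b\<close> is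
  nonnegative on \<open>{1..j}\<close>". By the recursion on the last step the claim reduces to
  \<open>[a r + b s \<ge> 0] * (A (r-1) * B s + A r * B (s-1) - A (r-1) * B (s-1)) = A r * B s\<close>.
  If \<open>A (r-1)\<close> and \<open>B (s-1)\<close> are both \<open>1\<close>, the bracket is \<open>B s + A r - 1\<close>, and it differs from \<open>A r * B s\<close> only
  when \<open>a r\<close> and \<open>b s\<close> are both negative, in which case the indicator in front vanishes. If one of
  them is \<open>0\<close>, both sides are \<open>0\<close>. The hypotheses at \<open>0\<close> take care of \<open>r = 0\<close> or \<open>s = 0\<close>.
\<close>

lemma signed_sum_quasi_shuffles:
  fixes a b :: "nat \<Rightarrow> real"
  assumes a0: "a 0 = 0" and b0: "b 0 = 0"
  shows "(\<Sum>p\<in>quasi_shuffles r s. (-1) ^ card (fst p \<union> snd p) * of_bool (path_nonneg a b p)) =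
    (-1) ^ (r + s) * (of_bool (\<forall>i\<in>{1..r}. 0 \<le> a i) * of_bool (\<forall>j\<in>{1..s}. 0 \<le> b j) :: real)"
    (is "?H r s = ?R r s")
proof (induction "r + s" arbitrary: r s rule: less_induct)
  case less
  show ?case
  proof (cases "r + s = 0")
    case True
    have "F = {} \<and> G = {}" if "(F, G) \<in> quasi_shuffles 0 0" for F G
      using quasi_shuffles_top[OF that refl] by simp
    moreover have "({}, {}) \<in> quasi_shuffles 0 0"
      by (auto simp: quasi_shuffles_def intro: exI[of _ 0])
    ultimately have "quasi_shuffles 0 0 = {({}, {})}" by auto
    then show ?thesis using True by (simp add: path_nonneg_def)
  next
    case False
    have "?H r s = (\<Sum>(r', s')\<in>predecessors r s. \<Sum>p\<in>quasi_shuffles r' s'.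
        - of_bool (0 \<le> a r + b s) * ((-1) ^ card (fst p \<union> snd p) * of_bool (path_nonneg a b p)))"
    proof (rule sum_quasi_shuffles_step)
      fix F G F' G' t
      assume *: "F' \<union> G' = {1..t}" "finite F'" "finite G'" "F = F' \<or> F = insert (Suc t) F'"
        "G = G' \<or> G = insert (Suc t) G'" "F \<union> G = {1..Suc t}" "card F = r" "card G = s"
      have "card (F \<union> G) = Suc (card (F' \<union> G'))" using *(1,6) by simp
      then show "(-1) ^ card (fst (F, G) \<union> snd (F, G)) * of_bool (path_nonneg a b (F, G)) =
        - of_bool (0 \<le> a r + b s) * ((-1) ^ card (fst (F', G') \<union> snd (F', G')) * (of_bool (path_nonneg a b (F', G')) :: real))"
        using path_nonneg_step[OF *(1,6,4,5), of a b] *(7,8) by simp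
    qed (use False in auto)
    also have "\<dots> = - of_bool (0 \<le> a r + b s) * (\<Sum>(r', s')\<in>predecessors r s. ?R r' s')"
    proof -
      have "(\<Sum>p\<in>quasi_shuffles r' s'. - of_bool (0 \<le> a r + b s) *
          ((-1) ^ card (fst p \<union> snd p) * of_bool (path_nonneg a b p))) = - of_bool (0 \<le> a r + b s) * ?R r' s'"
        if "(r', s') \<in> predecessors r s" for r' s'
      proof -
        have "r' + s' < r + s" using that by (auto simp: predecessors_def)
        from less[OF this] show ?thesis by (simp only: sum_distrib_left[symmetric])
      qed
      then show ?thesis unfolding sum_distrib_left by (intro sum.cong) auto
    qed
    also have "\<dots> = ?R r s"
    proof -
      have top: "(\<forall>i\<in>{1..Suc n}. P i) \<longleftrightarrow> P (Suc n) \<and> (\<forall>i\<in>{1..n}. P i)" for n and P :: "nat \<Rightarrow> bool"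
      proof -
        have "{1..Suc n} = insert (Suc n) {1..n}" by auto
        then show ?thesis by (simp only: ball_simps)
      qed
      consider "r = 0" "0 < s" | "0 < r" "s = 0" | "0 < r" "0 < s" using False by blast
      then show ?thesis
      proof cases
        case 1
        then obtain n where "s = Suc n" using gr0_implies_Suc by blast
        with 1 show ?thesis by (simp add: predecessors_simps top a0 del: One_nat_def)
      next
        case 2
        then obtain n where "r = Suc n" using gr0_implies_Suc by blast
        with 2 show ?thesis by (simp add: predecessors_simps top b0 del: One_nat_def)
      next
        case 3
        then obtain m n where "r = Suc m" "s = Suc n" using gr0_implies_Suc by metis
        then show ?thesis by (auto simp add: predecessors_simps top simp del: One_nat_def)
      qed
    qed
    finally show ?thesis .
  qed
qed

section \<open>Products of cones\<close>

lemma packed_set: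
  assumes "packed w"
  shows "set w = {1..max_letter w}"
proof -
  obtain r where r: "set w = {1..r}" using assms by (auto simp: packed_def)
  show ?thesis
  proof (cases "w = []")
    case False
    then have "{1..r} \<noteq> {}" using r by (metis set_empty)
    then have "Max (set w) = r" unfolding r by (intro Max_eqI) auto
    with False r show ?thesis by (simp add: max_letter_def)
  qed (simp add: max_letter_def)
qed

lemma card_set_packed: "packed w \<Longrightarrow> card (set w) = max_letter w"
  by (simp add: packed_set)

lemma pack_packed:
  assumes "packed w"
  shows "pack w = w"
  unfolding pack_def
proof (rule map_idI)
  fix b assume "b \<in> set w"
  then have "{c \<in> set w. c \<le> b} = {1..b}" using packed_set[OF assms] by auto
  then show "card {c \<in> set w. c \<le> b} = b" by simp
qed

text \<open>
  For packed \<open>w\<close> with set composition \<open>(B\<^sub>1, \<dots>, B\<^sub>r)\<close> this is \<open>B\<^sub>1 \<union> \<dots> \<union> B\<^sub>k\<close>, with positions counted from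
  \<open>0\<close>. The sums of \<open>x\<close> over these sets are the linear forms that define the cone.
\<close>

definition initial_segment :: "nat list \<Rightarrow> nat \<Rightarrow> nat set" where
  "initial_segment w k = {i. i < length w \<and> w ! i \<le> k}"

definition flag_of :: "nat list \<Rightarrow> nat set set" where
  "flag_of w = initial_segment w ` {1..max_letter w}"

lemma finite_initial_segment [simp]: "finite (initial_segment w k)"
  by (simp add: initial_segment_def)

lemma initial_segment_0: "packed w \<Longrightarrow> initial_segment w 0 = {}"
  using packed_set[of w] nth_mem[of _ w] unfolding initial_segment_def
  by (metis (mono_tags, lifting) atLeastAtMost_iff empty_Collect_eq le_zero_eq not_one_le_zero)

lemma initial_segment_mono: "k \<le> l \<Longrightarrow> initial_segment w k \<subseteq> initial_segment w l"
  by (auto simp: initial_segment_def)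

lemma mem_word_cone:
  assumes w: "packed w"
  shows "x \<in> word_cone w \<longleftrightarrow> x \<in> space (lebn (length w)) \<and> (\<forall>S\<in>flag_of w. 0 \<le> sum x S)"
proof -
  have "(\<Sum>j=1..k. \<Sum>i\<in>block w j. x i) = sum x (initial_segment w k)" for k
  proof -
    have "initial_segment w k = (\<Union>j\<in>{1..k}. block w j)"
    proof -
      have "1 \<le> w ! i" if "i < length w" for i using nth_mem[OF that] packed_set[OF w] by simp
      then show ?thesis by (auto simp: initial_segment_def block_def)
    qed
    then show ?thesis by (simp only:) (rule sum.UNION_disjoint[symmetric], auto simp: block_def)
  qed
  then show ?thesis by (simp add: word_cone_def flag_of_def)
qed

definition is_flag :: "'i set set \<Rightarrow> bool" where
  "is_flag U \<longleftrightarrow> finite U \<and> (\<forall>S\<in>U. finite S \<and> S \<noteq> {}) \<and> (\<forall>S\<in>U. \<forall>T\<in>U. S \<subseteq> T \<or> T \<subseteq> S)"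

lemma is_flag_flag_of:
  assumes w: "packed w"
  shows "is_flag (flag_of w)"
proof -
  have "initial_segment w k \<noteq> {}" if "k \<in> {1..max_letter w}" for k
  proof -
    have "k \<in> set w" using that packed_set[OF w] by simp
    then show ?thesis by (auto simp: in_set_conv_nth initial_segment_def)
  qed
  moreover have "initial_segment w k \<subseteq> initial_segment w l \<or> initial_segment w l \<subseteq> initial_segment w k" for k l
    by (cases "k \<le> l") (simp_all add: initial_segment_mono)
  ultimately show ?thesis by (auto simp: is_flag_def flag_of_def simp del: One_nat_def)
qed

lemma inj_on_initial_segment:
  assumes w: "packed w"
  shows "inj_on (initial_segment w) {1..max_letter w}"
proof (rule linorder_inj_onI)
  fix k l assume kl: "k < l" "k \<in> {1..max_letter w}" "l \<in> {1..max_letter w}"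
  then have "l \<in> set w" using packed_set[OF w] by simp
  then obtain i where "i < length w" "w ! i = l" by (auto simp: in_set_conv_nth)
  then have "i \<in> initial_segment w l - initial_segment w k" using kl by (simp add: initial_segment_def)
  then show "initial_segment w k \<noteq> initial_segment w l" by blast
qed auto

text \<open>
  The letter at position \<open>i\<close> is one more than the number of sets of the flag that miss \<open>i\<close>.
\<close>

lemma flag_of_inj:
  assumes w: "packed w" "packed w'" and len: "length w = length w'" and eq: "flag_of w = flag_of w'"
  shows "w = w'"
proof -
  have letter: "Suc (card {S \<in> flag_of w. i \<notin> S}) = w ! i" if w: "packed w" and i: "i < length w" for w i
  proof -
    have b: "1 \<le> w ! i" "w ! i \<le> max_letter w" using nth_mem[OF i] packed_set[OF w] by auto
    have "{S \<in> flag_of w. i \<notin> S} = initial_segment w ` {1..<w ! i}"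
      using b i by (auto simp: flag_of_def initial_segment_def)
    moreover have "inj_on (initial_segment w) {1..<w ! i}"
      by (rule inj_on_subset[OF inj_on_initial_segment[OF w]]) (use b in auto)
    ultimately have "card {S \<in> flag_of w. i \<notin> S} = w ! i - 1" by (simp add: card_image)
    then show ?thesis using b by simp
  qed
  show ?thesis
    by (rule nth_equalityI[OF len]) (use letter w len eq in metis)
qed

text \<open>
  The function that packs a word with letter set \<open>F\<close>, extended to letters outside \<open>F\<close>: its value at \<open>k\<close>
  is also the coordinate after \<open>k\<close> steps of a path which advances at the steps in \<open>F\<close>.
\<close>

abbreviation rank_in :: "nat set \<Rightarrow> nat \<Rightarrow> nat" where
  "rank_in F k \<equiv> card {c \<in> F. c \<le> k}"

lemma rank_le_iff:
  assumes "finite F" "b \<in> F"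
  shows "rank_in F b \<le> rank_in F k \<longleftrightarrow> b \<le> k"
proof
  assume *: "rank_in F b \<le> rank_in F k"
  show "b \<le> k"
  proof (rule ccontr)
    assume "\<not> b \<le> k"
    then have "{c \<in> F. c \<le> k} \<subset> {c \<in> F. c \<le> b}" using assms by auto
    then have "rank_in F k < rank_in F b" using assms by (intro psubset_card_mono) auto
    with * show False by simp
  qed
next
  assume "b \<le> k"
  then show "rank_in F b \<le> rank_in F k" using assms by (intro card_mono) auto
qed

lemma rank_inj: "finite F \<Longrightarrow> inj_on (rank_in F) F"
proof (rule inj_onI)
  fix a b assume "finite F" "a \<in> F" "b \<in> F" "rank_in F a = rank_in F b"
  then show "a = b" using rank_le_iff[of F a b] rank_le_iff[of F b a] by simp
qed

lemma rank_image:
  assumes "finite F"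
  shows "rank_in F ` F = {1..card F}"
proof -
  have s: "set (pack (sorted_list_of_set F)) = rank_in F ` F"
    using assms by (simp add: pack_def)
  have "packed (pack (sorted_list_of_set F))" by (rule packed_pack)
  then obtain r where "rank_in F ` F = {1..r}" unfolding packed_def s by blast
  moreover have "card (rank_in F ` F) = card F" using rank_inj[OF assms] by (rule card_image)
  ultimately show ?thesis by simp
qed

lemma card_set_eq_max_letter_pack: "card (set w) = max_letter (pack w)" for w :: "nat list"
proof -
  have "set (pack w) = rank_in (set w) ` set w"
    by (simp only: pack_def set_map)
  then have "card (set (pack w)) = card (set w)"
    using card_image[OF rank_inj[of "set w"]] by simp
  then show ?thesis by (simp add: card_set_packed packed_pack)
qed

lemma initial_segment_pack: "initial_segment w k = initial_segment (pack w) (rank_in (set w) k)"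
proof (rule set_eqI)
  fix i
  show "i \<in> initial_segment w k \<longleftrightarrow> i \<in> initial_segment (pack w) (rank_in (set w) k)"
  proof (cases "i < length w")
    case True
    then have "pack w ! i = rank_in (set w) (w ! i)" by (simp add: pack_def)
    then show ?thesis
      using True rank_le_iff[of "set w" "w ! i" k] by (simp add: initial_segment_def)
  qed (simp add: initial_segment_def)
qed

lemma pack_set_inj:
  assumes "pack w = pack w'" "set w = set w'"
  shows "w = (w' :: nat list)"
proof (rule nth_equalityI)
  show len: "length w = length w'" using arg_cong[OF assms(1), of length] by simp
  fix i assume i: "i < length w"
  have "rank_in (set w) (w ! i) = rank_in (set w) (w' ! i)"
    using arg_cong[OF assms(1), of "\<lambda>u. u ! i"] i len assms(2) by (simp add: pack_def)
  moreover have "w ! i \<in> set w" "w' ! i \<in> set w"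
    using nth_mem[of i w] nth_mem[of i w'] i len assms(2) by simp_all
  ultimately show "w ! i = w' ! i" 
    by (rule inj_onD[OF rank_inj[OF finite_set]])
qed

lemma ex_word_pack_set:
  assumes u: "packed u" and F: "finite (F :: nat set)" "card F = max_letter u"
  obtains w where "pack w = u" "set w = F"
proof -
  define w where "w = map (inv_into F (rank_in F)) u"
  have im: "rank_in F ` F = set u" using rank_image[OF F(1)] F(2) packed_set[OF u] by simp
  have set: "set w = F"
    unfolding w_def using rank_inj[OF F(1)] by (simp flip: im)
  have "pack w = map (\<lambda>k. rank_in F (inv_into F (rank_in F) k)) u"
    unfolding pack_def set by (simp add: w_def)
  also have "\<dots> = u" by (rule map_idI, rule f_inv_into_f) (simp add: im)
  finally show thesis using set that by blast
qed

definition product_words :: "nat list \<Rightarrow> nat list \<Rightarrow> nat list set" where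
  "product_words u v = {w. packed w \<and> (\<exists>w' w''. w = w' @ w'' \<and> pack w' = u \<and> pack w'' = v)}"

lemma length_product_words: "w \<in> product_words u v \<Longrightarrow> length w = length u + length v"
  by (auto simp: product_words_def)

lemma packed_product_words: "w \<in> product_words u v \<Longrightarrow> packed w"
  by (auto simp: product_words_def)

lemma finite_product_words: "finite (product_words u v)"
  by (rule finite_subset[OF _ finite_packed_length[of "length u + length v"]])
    (auto simp: length_product_words packed_product_words)

text \<open>
  A factor of \<open>w\<close> is determined by its packed form together with its set of letters, and any set of
  the right size occurs. The concatenation is packed iff the two letter sets together fill an
  initial interval, that is, iff they form a path.
\<close>

lemma product_words_bij:
  assumes u: "packed u" and v: "packed v"
  shows "bij_betw (\<lambda>w. (set (take (length u) w), set (drop (length u) w)))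
    (product_words u v) (quasi_shuffles (max_letter u) (max_letter v))"
    (is "bij_betw ?f _ _")
proof (rule bij_betw_imageI)
  show "inj_on ?f (product_words u v)"
  proof (rule inj_onI)
    fix w z assume "w \<in> product_words u v" "z \<in> product_words u v" and eq: "?f w = ?f z"
    then obtain w1 w2 z1 z2 where *: "w = w1 @ w2" "pack w1 = u" "pack w2 = v"
        "z = z1 @ z2" "pack z1 = u" "pack z2 = v"
      by (auto simp: product_words_def)
    then have len: "length w1 = length u" "length z1 = length u" by (metis length_pack)+
    have "pack w1 = pack z1" "set w1 = set z1" "pack w2 = pack z2" "set w2 = set z2"
      using * eq len by simp_all
    then have "w1 = z1" "w2 = z2" by (simp_all add: pack_set_inj)
    with * show "w = z" by simp
  qed
  show "?f ` product_words u v = quasi_shuffles (max_letter u) (max_letter v)"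
  proof (intro equalityI subsetI)
    fix p assume "p \<in> ?f ` product_words u v"
    then obtain w1 w2 where *: "packed (w1 @ w2)" "pack w1 = u" "pack w2 = v" "p = ?f (w1 @ w2)"
      by (auto simp: product_words_def)
    then have "length w1 = length u" by auto
    then have "p = (set w1, set w2)" using * by simp
    moreover have "\<exists>t. set w1 \<union> set w2 = {1..t}" using *(1) by (simp add: packed_def)
    ultimately show "p \<in> quasi_shuffles (max_letter u) (max_letter v)"
      using * by (auto simp: quasi_shuffles_def card_set_eq_max_letter_pack)
  next
    fix p assume "p \<in> quasi_shuffles (max_letter u) (max_letter v)"
    then obtain F G t where p: "p = (F, G)" "F \<union> G = {1..t}" "card F = max_letter u" "card G = max_letter v"
      by (auto simp: quasi_shuffles_def)
    then have "finite F" "finite G" by (metis finite_Un finite_atLeastAtMost)+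
    then obtain w1 w2 where w: "pack w1 = u" "set w1 = F" "pack w2 = v" "set w2 = G"
      using ex_word_pack_set[OF u] ex_word_pack_set[OF v] p by metis
    then have len: "length w1 = length u" by auto
    have "set (w1 @ w2) = {1..t}" using w p by simp
    then have "packed (w1 @ w2)" unfolding packed_def by blast
    then have "w1 @ w2 \<in> product_words u v"
      using w by (auto simp: product_words_def)
    moreover have "?f (w1 @ w2) = p" using w p len by simp
    ultimately show "p \<in> ?f ` product_words u v" by (intro image_eqI[of p ?f "w1 @ w2"]) simp_all
  qed
qed

lemma sum_initial_segment_append:
  "sum x (initial_segment (w @ w') k) =
    sum x (initial_segment w k) + sum (\<lambda>i. x (length w + i)) (initial_segment w' k)"
proof -
  have "initial_segment (w @ w') k = initial_segment w k \<union> (+) (length w) ` initial_segment w' k"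
  proof (intro equalityI subsetI)
    fix i assume i: "i \<in> initial_segment (w @ w') k"
    show "i \<in> initial_segment w k \<union> (+) (length w) ` initial_segment w' k"
    proof (cases "i < length w")
      case True
      with i show ?thesis by (simp add: initial_segment_def nth_append)
    next
      case False
      with i have "i - length w \<in> initial_segment w' k" "i = length w + (i - length w)"
        by (auto simp: initial_segment_def nth_append)
      then show ?thesis by blast
    qed
  qed (auto simp: initial_segment_def nth_append)
  moreover have "initial_segment w k \<inter> (+) (length w) ` initial_segment w' k = {}"
    by (auto simp: initial_segment_def)
  ultimately show ?thesis
    by (simp add: sum.union_disjoint sum.reindex comp_def)
qed

text \<open>
  The inequality of \<open>K\<^sub>w\<close> for the letter \<open>k\<close> concerns the coordinates whose letter is at most \<open>k\<close>. In each
  factor these form an initial segment, up to the rank of \<open>k\<close> among the letters of that factor, which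
  is the corresponding coordinate of the path after \<open>k\<close> steps.
\<close>

lemma path_nonneg_product_word:
  assumes w: "w \<in> product_words u v" and x: "x \<in> space (lebn (length u + length v))"
  shows "path_nonneg (\<lambda>i. sum x (initial_segment u i)) (\<lambda>j. sum (\<lambda>i. x (length u + i)) (initial_segment v j))
      (set (take (length u) w), set (drop (length u) w)) \<longleftrightarrow> x \<in> word_cone w"
proof -
  obtain w1 w2 where *: "packed w" "w = w1 @ w2" "pack w1 = u" "pack w2 = v"
    using w by (auto simp: product_words_def)
  then have len: "length w1 = length u" by auto
  have split: "sum x (initial_segment w k) = sum x (initial_segment u (rank_in (set w1) k)) +
      sum (\<lambda>i. x (length u + i)) (initial_segment v (rank_in (set w2) k))" for k
    unfolding *(2) sum_initial_segment_append len initial_segment_pack[of w1] initial_segment_pack[of w2] *(3,4) ..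
  have "x \<in> word_cone w \<longleftrightarrow> (\<forall>k\<in>{1..max_letter w}. 0 \<le> sum x (initial_segment w k))"
    using x mem_word_cone[OF *(1)] length_product_words[OF w] by (simp add: flag_of_def)
  also have "{1..max_letter w} = set w1 \<union> set w2" using packed_set[OF *(1)] * by simp
  finally show ?thesis unfolding split using * len by (simp add: path_nonneg_def)
qed

lemma mem_cart_prod_word_cone:
  assumes u: "packed u" and v: "packed v" and x: "x \<in> space (lebn (length u + length v))"
  shows "x \<in> cart_prod (length u) (length v) (word_cone u) (word_cone v) \<longleftrightarrow>
    (\<forall>i\<in>{1..max_letter u}. 0 \<le> sum x (initial_segment u i)) \<and>
    (\<forall>j\<in>{1..max_letter v}. 0 \<le> sum (\<lambda>i. x (length u + i)) (initial_segment v j))"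
proof -
  have "sum (front_coords (length u) x) (initial_segment u i) = sum x (initial_segment u i)" for i
    by (rule sum.cong) (auto simp: front_coords_def initial_segment_def)
  moreover have "sum (back_coords (length u) (length v) x) (initial_segment v j) =
      sum (\<lambda>i. x (length u + i)) (initial_segment v j)" for j
    by (rule sum.cong) (auto simp: back_coords_def initial_segment_def)
  moreover have "front_coords (length u) x \<in> space (lebn (length u))"
      "back_coords (length u) (length v) x \<in> space (lebn (length v))"
    by (auto simp: front_coords_def back_coords_def space_lebn)
  ultimately show ?thesis
    using x mem_word_cone[OF u] mem_word_cone[OF v] by (simp add: cart_prod_def flag_of_def)
qed

text \<open>
  The product formula at a single point. The largest letter of \<open>w\<close> is the number of steps of its path,
  so the signs of both sums agree up to the overall sign \<open>e\<close>.
\<close>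

lemma indicator_cart_prod_word_cone:
  assumes u: "packed u" and v: "packed v" and x: "x \<in> space (lebn (length u + length v))"
  shows "indicator (cart_prod (length u) (length v) (word_cone u) (word_cone v)) x =
    (\<Sum>w\<in>product_words u v. (-1) ^ (max_letter u + max_letter v + max_letter w) * (indicator (word_cone w) x :: real))"
proof -
  define a where "a = (\<lambda>i. sum x (initial_segment u i))"
  define b where "b = (\<lambda>j. sum (\<lambda>i. x (length u + i)) (initial_segment v j))"
  define e :: real where "e = (-1) ^ (max_letter u + max_letter v)"
  let ?f = "\<lambda>w. (set (take (length u) w), set (drop (length u) w))"
  have ab: "a 0 = 0" "b 0 = 0" using u v by (simp_all add: a_def b_def initial_segment_0)
  have ee: "e * e = 1" by (simp add: e_def flip: power_add mult_2)
  have card: "card (fst (?f w) \<union> snd (?f w)) = max_letter w" if "w \<in> product_words u v" for w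
    using card_set_packed[OF packed_product_words[OF that]]
    by (simp flip: set_append)
  have path: "path_nonneg a b (?f w) \<longleftrightarrow> x \<in> word_cone w" if "w \<in> product_words u v" for w
    unfolding a_def b_def using that x by (rule path_nonneg_product_word)
  have "indicator (cart_prod (length u) (length v) (word_cone u) (word_cone v)) x =
      e * (e * (of_bool (\<forall>i\<in>{1..max_letter u}. 0 \<le> a i) * of_bool (\<forall>j\<in>{1..max_letter v}. 0 \<le> b j)))"
    unfolding mult.assoc[symmetric] ee
    using mem_cart_prod_word_cone[OF u v x] by (simp add: indicator_def a_def b_def)
  also have "\<dots> = e * (\<Sum>p\<in>quasi_shuffles (max_letter u) (max_letter v).
      (-1) ^ card (fst p \<union> snd p) * of_bool (path_nonneg a b p))"
    unfolding e_def by (subst signed_sum_quasi_shuffles[where a = a and b = b, OF ab]) simp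
  also have "\<dots> = e * (\<Sum>w\<in>product_words u v. (-1) ^ card (fst (?f w) \<union> snd (?f w)) * of_bool (path_nonneg a b (?f w)))"
    by (simp only: sum.reindex_bij_betw[OF product_words_bij[OF u v], symmetric])
  also have "\<dots> = e * (\<Sum>w\<in>product_words u v. (-1) ^ max_letter w * indicator (word_cone w) x)"
  proof (rule arg_cong[where f = "(*) e"], rule sum.cong[OF refl])
    fix w assume w: "w \<in> product_words u v"
    show "(-1) ^ card (fst (?f w) \<union> snd (?f w)) * of_bool (path_nonneg a b (?f w)) =
        (-1) ^ max_letter w * (indicator (word_cone w) x :: real)"
      unfolding card[OF w] path[OF w] indicator_def ..
  qed
  also have "\<dots> = (\<Sum>w\<in>product_words u v. (-1) ^ (max_letter u + max_letter v + max_letter w) * indicator (word_cone w) x)"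
    by (simp add: sum_distrib_left e_def power_add mult.assoc)
  finally show ?thesis .
qed

section \<open>Linear independence of cones given by flags\<close>

text \<open>
  A small step in a direction of increase keeps the sign condition \<open>0 \<le> B\<close>, also on the wall \<open>B = 0\<close>.
\<close>

lemma eventually_sign_affine:
  fixes B Q :: real
  assumes "B \<noteq> 0 \<or> 0 < Q"
  shows "\<forall>\<^sub>F t in at_right 0. 0 \<le> B + t * Q \<longleftrightarrow> 0 \<le> B"
proof -
  have lim: "((\<lambda>t. B + t * Q) \<longlongrightarrow> B) (at_right 0)"
    by (auto intro!: tendsto_eq_intros)
  consider "B < 0" | "B > 0" | "B = 0" "0 < Q" using assms by linarith
  then show ?thesis
  proof cases
    case 1
    with order_tendstoD(2)[OF lim, of 0] show ?thesis by (auto elim: eventually_mono)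
  next
    case 2
    with order_tendstoD(1)[OF lim, of 0] show ?thesis by (auto elim: eventually_mono)
  next
    case 3
    have "\<forall>\<^sub>F t :: real in at_right 0. 0 < t" by (simp add: eventually_at_right_less)
    then show ?thesis by (rule eventually_mono) (use 3 in auto)
  qed
qed

lemma eventually_affine_neq_0:
  fixes B Q :: real
  assumes "Q \<noteq> 0"
  shows "\<forall>\<^sub>F t in at_right 0. B + t * Q \<noteq> 0"
proof (cases "B = 0")
  case True
  have "\<forall>\<^sub>F t :: real in at_right 0. 0 < t" by (simp add: eventually_at_right_less)
  then show ?thesis by (rule eventually_mono) (use assms True in auto)
next
  case False
  have "((\<lambda>t. B + t * Q) \<longlongrightarrow> B) (at_right 0)" by (auto intro!: tendsto_eq_intros)
  from tendsto_imp_eventually_ne[OF this False] show ?thesis .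
qed

text \<open>
  The points \<open>x\<close> and \<open>x'\<close> lie on and just behind the wall \<open>x(V) = 0\<close>, and no wall of another set in \<open>\<S>\<close>
  is crossed between them. On the sets above \<open>V\<close>, the point \<open>x\<close> has the signs that the arbitrary point
  \<open>y\<close> has on their parts outside \<open>V\<close>. The point \<open>x\<close> is a small perturbation of \<open>y\<close> set to \<open>0\<close> on \<open>V\<close>.
\<close>

lemma cross_wall:
  fixes y :: "'i \<Rightarrow> real"
  assumes fin: "finite \<S>" "\<And>S. S \<in> \<S> \<Longrightarrow> finite S" and V: "finite V" "V \<noteq> {}"
  obtains x x' :: "'i \<Rightarrow> real" where
    "sum x V = 0" "sum x' V < 0"
    "\<And>S. S \<in> \<S> \<Longrightarrow> S \<noteq> V \<Longrightarrow> 0 \<le> sum x' S \<longleftrightarrow> 0 \<le> sum x S"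
    "\<And>S. S \<in> \<S> \<Longrightarrow> V \<subset> S \<Longrightarrow> 0 \<le> sum x S \<longleftrightarrow> 0 \<le> sum y (S - V)"
proof -
  obtain v where v: "v \<in> V" using V by blast
  define m where "m = real (card V)"
  \<comment> \<open>The direction of the perturbation. The weights are chosen such that, among the sets containing
    \<open>v\<close>, only \<open>V\<close> itself has total weight \<open>0\<close>, and the sets above \<open>V\<close> have positive weight. Sets without \<open>v\<close> are not affected by the final move
    from \<open>x\<close> to \<open>x'\<close>, which changes only the coordinate \<open>v\<close>.\<close>
  define q where "q = (\<lambda>i. if i = v then 1 - m else if i \<in> V then 1 else m)"
  define base where "base = (\<lambda>i. if i \<in> V then 0 else y i)"
  have sq: "sum q S = m * real (card (S - V)) - real (card (V - S))" if S: "finite S" "v \<in> S" for S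
  proof -
    have split: "S = insert v (S \<inter> V - {v}) \<union> (S - V)" using S v by blast
    have "sum q S = sum q (insert v (S \<inter> V - {v})) + sum q (S - V)"
      by (subst split, rule sum.union_disjoint) (use S v in auto)
    also have "sum q (insert v (S \<inter> V - {v})) = (1 - m) + real (card (S \<inter> V - {v}))"
      using S by (subst sum.insert) (auto simp: q_def)
    also have "sum q (S - V) = m * real (card (S - V))"
      using v by (subst sum.cong[OF refl, of _ _ "\<lambda>_. m"]) (auto simp: q_def)
    also have "real (card (S \<inter> V - {v})) = m - real (card (V - S)) - 1"
    proof -
      have "card V = card (insert v (S \<inter> V - {v})) + card (V - S)"
        by (subst card_Un_disjoint[symmetric]) (use S V v in \<open>auto intro!: arg_cong[of _ _ card]\<close>)
      also have "card (insert v (S \<inter> V - {v})) = Suc (card (S \<inter> V - {v}))"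
        using S by (subst card_insert_disjoint) auto
      finally show ?thesis by (simp add: m_def)
    qed
    finally show ?thesis by simp
  qed
  have sqV: "sum q V = 0" using sq[OF V(1) v] by simp
  have q0: "sum q S \<noteq> 0" if S: "finite S" "v \<in> S" "S \<noteq> V" for S
  proof (cases "S \<subseteq> V")
    case True
    then have "card (S - V) = 0" "0 < card (V - S)"
      using S V by (auto simp: card_gt_0_iff Diff_eq_empty_iff[THEN iffD2])
    then show ?thesis using sq[OF S(1,2)] by simp
  next
    case False
    then have "1 \<le> card (S - V)" using S by (simp add: Suc_le_eq card_gt_0_iff)
    then have "m * 1 \<le> m * real (card (S - V))" by (intro mult_left_mono) (auto simp: m_def)
    moreover have "real (card (V - S)) < m"
      unfolding m_def of_nat_less_iff using S V v by (intro psubset_card_mono) auto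
    ultimately show ?thesis using sq[OF S(1,2)] by linarith
  qed
  have qpos: "0 < sum q S" if S: "finite S" "V \<subset> S" for S
  proof -
    have "V - S = {}" using S by blast
    then have "0 < card (S - V)" "card (V - S) = 0" using S by (auto simp: card_gt_0_iff)
    moreover have "0 < m" using V by (simp add: m_def card_gt_0_iff)
    moreover have "sum q S = m * real (card (S - V)) - real (card (V - S))"
      using sq[OF S(1)] S v by blast
    ultimately show ?thesis by simp
  qed
  have sbase: "sum base S = sum y (S - V)" if "finite S" for S
    unfolding base_def using that by (simp add: sum.If_cases Diff_eq)
  have sx: "sum (\<lambda>i. base i + t * q i) S = sum base S + t * sum q S" for t S
    by (simp add: sum.distrib sum_distrib_left)
  have "\<forall>\<^sub>F t in at_right 0. \<forall>S\<in>\<S>. (v \<in> S \<and> S \<noteq> V \<longrightarrow> sum base S + t * sum q S \<noteq> 0) \<and>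
      (V \<subset> S \<longrightarrow> (0 \<le> sum base S + t * sum q S \<longleftrightarrow> 0 \<le> sum base S))"
  proof (intro eventually_ball_finite ballI eventually_conj)
    fix S assume S: "S \<in> \<S>"
    show "\<forall>\<^sub>F t in at_right 0. v \<in> S \<and> S \<noteq> V \<longrightarrow> sum base S + t * sum q S \<noteq> 0"
    proof (cases "v \<in> S \<and> S \<noteq> V")
      case True
      then show ?thesis
        using eventually_affine_neq_0[OF q0[OF fin(2)[OF S]]] by simp
    next
      case False
      then show ?thesis by (intro always_eventually) blast
    qed
    show "\<forall>\<^sub>F t in at_right 0. V \<subset> S \<longrightarrow> (0 \<le> sum base S + t * sum q S \<longleftrightarrow> 0 \<le> sum base S)"
    proof (cases "V \<subset> S")
      case True
      then show ?thesis
        using eventually_sign_affine[OF disjI2, OF qpos[OF fin(2)[OF S]]] by simp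
    qed simp
  qed (rule fin)
  from eventually_happens'[OF trivial_limit_at_right_real this]
  obtain t where t: "\<And>S. S \<in> \<S> \<Longrightarrow> v \<in> S \<Longrightarrow> S \<noteq> V \<Longrightarrow> sum base S + t * sum q S \<noteq> 0"
      "\<And>S. S \<in> \<S> \<Longrightarrow> V \<subset> S \<Longrightarrow> (0 \<le> sum base S + t * sum q S \<longleftrightarrow> 0 \<le> sum base S)"
    by blast
  define x where "x = (\<lambda>i. base i + t * q i)"
  have "\<forall>\<^sub>F e in at_right 0. \<forall>S\<in>{S \<in> \<S>. v \<in> S \<and> S \<noteq> V}. 0 \<le> sum x S + e * (-1) \<longleftrightarrow> 0 \<le> sum x S"
    using fin t(1)
    by (intro eventually_ball_finite ballI eventually_sign_affine) (auto simp: x_def sx)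
  moreover have "\<forall>\<^sub>F e :: real in at_right 0. 0 < e" by (simp add: eventually_at_right_less)
  ultimately have "\<forall>\<^sub>F e in at_right 0. 0 < e \<and> (\<forall>S\<in>{S \<in> \<S>. v \<in> S \<and> S \<noteq> V}. 0 \<le> sum x S + e * (-1) \<longleftrightarrow> 0 \<le> sum x S)"
    by eventually_elim simp
  from eventually_happens'[OF trivial_limit_at_right_real this]
  obtain e where e: "0 < e"
      "\<And>S. S \<in> \<S> \<Longrightarrow> v \<in> S \<Longrightarrow> S \<noteq> V \<Longrightarrow> 0 \<le> sum x S - e \<longleftrightarrow> 0 \<le> sum x S"
    by auto
  define x' where "x' = x(v := x v - e)"
  have sx': "sum x' S = sum x S - (if v \<in> S then e else 0)" if "finite S" for S
  proof (cases "v \<in> S")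
    case True
    have "sum x' S = x' v + sum x' (S - {v})" "sum x S = x v + sum x (S - {v})"
      using that True by (simp_all add: sum.remove)
    moreover have "sum x' (S - {v}) = sum x (S - {v})" by (rule sum.cong) (auto simp: x'_def)
    ultimately show ?thesis using True by (simp add: x'_def)
  next
    case False
    then have "sum x' S = sum x S" by (intro sum.cong) (auto simp: x'_def)
    with False show ?thesis by simp
  qed
  have xV: "sum x V = 0" using sbase[OF V(1)] sqV by (simp add: x_def sx)
  show thesis
  proof (rule that[of x x'])
    show "sum x V = 0" by (rule xV)
    show "sum x' V < 0" using sx'[OF V(1)] xV v e by simp
    show "0 \<le> sum x' S \<longleftrightarrow> 0 \<le> sum x S" if "S \<in> \<S>" "S \<noteq> V" for S
      using sx'[OF fin(2)[OF that(1)]] e(2)[OF that(1) _ that(2)] by auto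
    show "0 \<le> sum x S \<longleftrightarrow> 0 \<le> sum y (S - V)" if "S \<in> \<S>" "V \<subset> S" for S
      using t(2)[OF that] sbase[OF fin(2)[OF that(1)]] by (simp add: x_def sx)
  qed
qed

text \<open>
  Induction on a common bound for the lengths of the flags. The difference of the vanishing sum at
  the two points given by \<open>cross_wall\<close> is the vanishing sum for the shorter flags of the sets
  \<open>S - V\<close>, because \<open>V\<close> is smallest possible and hence the first set of every flag that contains it.
\<close>

lemma flag_cones_independent:
  fixes c :: "'i set set \<Rightarrow> real"
  assumes fin: "finite \<F>" and flag: "\<And>U. U \<in> \<F> \<Longrightarrow> is_flag U"
    and zero: "\<And>x :: 'i \<Rightarrow> real. (\<Sum>U\<in>\<F>. c U * of_bool (\<forall>S\<in>U. 0 \<le> sum x S)) = 0"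
    and U: "U \<in> \<F>"
  shows "c U = 0"
proof -
  have "\<forall>U\<in>\<F>. c U = 0" if bound: "\<forall>U\<in>\<F>. card U \<le> n" for n
    using fin flag bound zero
  proof (induction n arbitrary: \<F> c)
    case 0
    then have e: "U = {}" if "U \<in> \<F>" for U using that by (auto simp: is_flag_def)
    show ?case
    proof
      fix U assume U: "U \<in> \<F>"
      then have "\<F> = {{}}" using e by auto
      with 0(4) e[OF U] show "c U = 0" by simp
    qed
  next
    case (Suc n)
    define \<G> where "\<G> = {U \<in> \<F>. c U \<noteq> 0}"
    have finG: "finite \<G>" using Suc.prems(1) by (simp add: \<G>_def)
    have flagG: "is_flag U" if "U \<in> \<G>" for U using that Suc.prems(2) by (simp add: \<G>_def)
    have zeroG: "(\<Sum>U\<in>\<G>. c U * of_bool (\<forall>S\<in>U. 0 \<le> sum x S)) = 0" for x :: "'i \<Rightarrow> real"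
    proof -
      have "(\<Sum>U\<in>\<G>. c U * of_bool (\<forall>S\<in>U. 0 \<le> sum x S)) = (\<Sum>U\<in>\<F>. c U * of_bool (\<forall>S\<in>U. 0 \<le> sum x S))"
        by (rule sum.mono_neutral_left) (use Suc.prems(1) in \<open>auto simp: \<G>_def\<close>)
      then show ?thesis using Suc.prems(4) by simp
    qed
    have "\<G> = {}"
    proof (rule ccontr)
      assume ne: "\<G> \<noteq> {}"
      have "\<Union>\<G> \<noteq> {}"
      proof
        assume "\<Union>\<G> = {}"
        then have G: "\<G> = {{}}" using ne by auto
        then have "c {} = 0" using zeroG[of "\<lambda>_. 0"] by simp
        moreover have "{} \<in> \<G>" using G by simp
        ultimately show False by (simp add: \<G>_def)
      qed
      then obtain V where V: "V \<in> \<Union>\<G>" and min: "\<And>S. S \<in> \<Union>\<G> \<Longrightarrow> card V \<le> card S"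
        using ex_has_least_nat[of "\<lambda>S. S \<in> \<Union>\<G>" _ card] by blast
      define \<H> where "\<H> = {U \<in> \<G>. V \<in> U}"
      have finS: "finite (\<Union>\<G>)" and finS': "\<And>S. S \<in> \<Union>\<G> \<Longrightarrow> finite S"
        using finG flagG by (auto simp: is_flag_def)
      have Vfin: "finite V" "V \<noteq> {}" using V flagG by (auto simp: is_flag_def)
      have above: "V \<subset> S" if U: "U \<in> \<H>" and S: "S \<in> U" "S \<noteq> V" for U S
      proof -
        have UG: "U \<in> \<G>" "V \<in> U" using U by (auto simp: \<H>_def)
        have "V \<subseteq> S \<or> S \<subseteq> V" using flagG[OF UG(1)] UG(2) S by (auto simp: is_flag_def)
        moreover have "\<not> S \<subset> V"
          using psubset_card_mono[OF Vfin(1), of S] min[of S] S UG by (meson UnionI leD)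
        ultimately show ?thesis using S by blast
      qed
      \<comment> \<open>Since \<open>V\<close> lies below all other sets of a flag in \<open>\<H>\<close>, removing it from them loses no information.\<close>
      define link where "link = (\<lambda>U. (\<lambda>S. S - V) ` (U - {V}))"
      define unlink where "unlink = (\<lambda>W. insert V ((\<union>) V ` W))"
      have unlink: "unlink (link U) = U" if U: "U \<in> \<H>" for U
      proof -
        have "(\<union>) V ` link U = (\<lambda>S. V \<union> (S - V)) ` (U - {V})" by (simp add: link_def image_image)
        also have "\<dots> = (\<lambda>S. S) ` (U - {V})" by (rule image_cong) (use above[OF U] in auto)
        finally show ?thesis using U by (auto simp: unlink_def \<H>_def)
      qed
      have inj: "inj_on link \<H>" by (rule inj_on_inverseI[of _ unlink]) (rule unlink)
      have "\<forall>W\<in>link ` \<H>. (c \<circ> unlink) W = 0"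
      proof (rule Suc.IH)
        show "finite (link ` \<H>)" using finG by (simp add: \<H>_def)
        show "is_flag W" if W: "W \<in> link ` \<H>" for W
        proof -
          obtain U where U: "U \<in> \<H>" "W = link U" using W by blast
          have "is_flag U" using flagG U by (simp add: \<H>_def)
          moreover have "S - V \<noteq> {}" if "S \<in> U - {V}" for S using above[OF U(1)] that by blast
          moreover have "S - V \<subseteq> T - V \<or> T - V \<subseteq> S - V" if "S \<subseteq> T \<or> T \<subseteq> S" for S T
            using that by blast
          ultimately show ?thesis unfolding U(2) link_def is_flag_def by simp
        qed
        show "\<forall>W\<in>link ` \<H>. card W \<le> n"
        proof clarsimp
          fix U assume U: "U \<in> \<H>"
          have fU: "finite U" "V \<in> U" "card U \<le> Suc n"
            using U Suc.prems(3) flagG by (auto simp: \<H>_def \<G>_def is_flag_def)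
          have "card (link U) \<le> card (U - {V})" unfolding link_def using fU by (intro card_image_le) simp
          also have "\<dots> = card U - 1" using fU by (simp add: card_Diff_singleton)
          finally show "card (link U) \<le> n" using fU by simp
        qed
        fix y :: "'i \<Rightarrow> real"
        obtain x x' :: "'i \<Rightarrow> real" where x: "sum x V = 0" "sum x' V < 0"
          "\<And>S. S \<in> \<Union>\<G> \<Longrightarrow> S \<noteq> V \<Longrightarrow> 0 \<le> sum x' S \<longleftrightarrow> 0 \<le> sum x S"
          "\<And>S. S \<in> \<Union>\<G> \<Longrightarrow> V \<subset> S \<Longrightarrow> 0 \<le> sum x S \<longleftrightarrow> 0 \<le> sum y (S - V)"
          using cross_wall[OF finS finS' Vfin] by blast
        \<comment> \<open>Behind the wall every flag through \<open>V\<close> loses the point, and every other flag sees no change.\<close>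
        have jump: "of_bool (\<forall>S\<in>U. 0 \<le> sum x S) - of_bool (\<forall>S\<in>U. 0 \<le> sum x' S) =
            (if V \<in> U then of_bool (\<forall>S\<in>link U. 0 \<le> sum y S) else (0::real))" if U: "U \<in> \<G>" for U
        proof (cases "V \<in> U")
          case True
          have UH: "U \<in> \<H>" using U True by (simp add: \<H>_def)
          have "(\<forall>S\<in>U. 0 \<le> sum x S) \<longleftrightarrow> (\<forall>S\<in>U - {V}. 0 \<le> sum x S)" using x(1) by auto
          also have "\<dots> \<longleftrightarrow> (\<forall>S\<in>U - {V}. 0 \<le> sum y (S - V))"
            by (intro ball_cong refl x(4)) (use U above[OF UH] in auto)
          finally have "(\<forall>S\<in>U. 0 \<le> sum x S) \<longleftrightarrow> (\<forall>S\<in>link U. 0 \<le> sum y S)" by (simp add: link_def)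
          moreover have "\<not> (\<forall>S\<in>U. 0 \<le> sum x' S)" using True x(2) by (auto simp: not_le)
          ultimately show ?thesis using True by simp
        next
          case False
          have "(\<forall>S\<in>U. 0 \<le> sum x' S) \<longleftrightarrow> (\<forall>S\<in>U. 0 \<le> sum x S)"
            by (intro ball_cong refl x(3)) (use U False in auto)
          with False show ?thesis by simp
        qed
        have "(\<Sum>W\<in>link ` \<H>. (c \<circ> unlink) W * of_bool (\<forall>S\<in>W. 0 \<le> sum y S)) =
            (\<Sum>U\<in>\<H>. c U * of_bool (\<forall>S\<in>link U. 0 \<le> sum y S))"
          by (simp add: sum.reindex[OF inj] unlink)
        also have "\<dots> = (\<Sum>U\<in>\<G>. c U * (if V \<in> U then of_bool (\<forall>S\<in>link U. 0 \<le> sum y S) else 0))"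
          unfolding \<H>_def by (rule sum.mono_neutral_cong_left) (use finG in auto)
        also have "\<dots> = (\<Sum>U\<in>\<G>. c U * of_bool (\<forall>S\<in>U. 0 \<le> sum x S)) - (\<Sum>U\<in>\<G>. c U * of_bool (\<forall>S\<in>U. 0 \<le> sum x' S))"
          unfolding sum_subtractf[symmetric] right_diff_distrib[symmetric] by (intro sum.cong refl) (simp only: jump)
        finally show "(\<Sum>W\<in>link ` \<H>. (c \<circ> unlink) W * of_bool (\<forall>S\<in>W. 0 \<le> sum y S)) = 0"
          by (simp add: zeroG)
      qed
      then have "c U = 0" if "U \<in> \<H>" for U using that unlink by simp
      then show False using V by (auto simp: \<H>_def \<G>_def)
    qed
    then show ?case by (auto simp: \<G>_def)
  qed
  from this[of "Max (card ` \<F>)"] show ?thesis using fin U by simp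
qed

section \<open>The algebra generated by the cones\<close>

text \<open>
  On the box of all \<open>y\<close> with \<open>x i \<le> y i \<le> x i + e\<close>, for small \<open>e\<close>, every condition \<open>0 \<le> sum y S\<close> has the
  same truth value as at \<open>x\<close>. The box has positive measure, so it is not contained in a null set.
\<close>

lemma AE_flag_sum_eq_0_imp:
  fixes c :: "nat set set \<Rightarrow> real" and x :: "nat \<Rightarrow> real"
  assumes fin: "finite \<F>" and flag: "\<And>U. U \<in> \<F> \<Longrightarrow> is_flag U \<and> \<Union>U \<subseteq> {..<n}"
    and ae: "AE x in lebn n. (\<Sum>U\<in>\<F>. c U * of_bool (\<forall>S\<in>U. 0 \<le> sum x S)) = 0"
  shows "(\<Sum>U\<in>\<F>. c U * of_bool (\<forall>S\<in>U. 0 \<le> sum x S)) = 0"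
proof -
  let ?f = "\<lambda>x. \<Sum>U\<in>\<F>. c U * of_bool (\<forall>S\<in>U. 0 \<le> sum x S)"
  have S: "finite S" "S \<subseteq> {..<n}" "0 < card S" if SF: "S \<in> \<Union>\<F>" for S
  proof -
    obtain U where U: "U \<in> \<F>" "S \<in> U" using SF by blast
    have "is_flag U" "\<Union>U \<subseteq> {..<n}" using flag[OF U(1)] by auto
    with U(2) show "finite S" "S \<subseteq> {..<n}" "0 < card S" by (auto simp: is_flag_def card_gt_0_iff)
  qed
  have finS: "finite (\<Union>\<F>)" using fin flag by (auto simp: is_flag_def)
  have "\<forall>\<^sub>F e in at_right 0. \<forall>S\<in>\<Union>\<F>. 0 \<le> sum x S + e * real (card S) \<longleftrightarrow> 0 \<le> sum x S"
    using finS S(3) by (intro eventually_ball_finite ballI eventually_sign_affine) auto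
  moreover have "\<forall>\<^sub>F e :: real in at_right 0. 0 < e" by (simp add: eventually_at_right_less)
  ultimately have "\<forall>\<^sub>F e in at_right 0. 0 < e \<and>
      (\<forall>S\<in>\<Union>\<F>. 0 \<le> sum x S + e * real (card S) \<longleftrightarrow> 0 \<le> sum x S)"
    by eventually_elim simp
  from eventually_happens'[OF trivial_limit_at_right_real this]
  obtain e where e: "0 < e"
      "\<And>S. S \<in> \<Union>\<F> \<Longrightarrow> 0 \<le> sum x S + e * real (card S) \<longleftrightarrow> 0 \<le> sum x S"
    by blast
  define box where "box = (\<Pi>\<^sub>E i\<in>{..<n}. {x i..x i + e})"
  have same: "?f y = ?f x" if y: "y \<in> box" for y
  proof -
    have "0 \<le> sum y S \<longleftrightarrow> 0 \<le> sum x S" if SF: "S \<in> \<Union>\<F>" for S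
    proof -
      have yi: "x i \<le> y i" "y i \<le> x i + e" if "i \<in> S" for i
        using y S(2)[OF SF] that by (auto simp: box_def PiE_iff)
      have "sum x S \<le> sum y S" by (rule sum_mono) (rule yi)
      moreover have "sum y S \<le> (\<Sum>i\<in>S. x i + e)" by (rule sum_mono) (rule yi)
      then have "sum y S \<le> sum x S + e * real (card S)" by (simp add: sum.distrib mult.commute)
      ultimately show ?thesis using e(2)[OF SF] by linarith
    qed
    then have "(\<forall>S\<in>U. 0 \<le> sum y S) \<longleftrightarrow> (\<forall>S\<in>U. 0 \<le> sum x S)" if "U \<in> \<F>" for U
      using that by blast
    then show ?thesis by simp
  qed
  have box: "box \<in> sets (lebn n)" "emeasure (lebn n) box = (\<Prod>i<n. ennreal e)"
    unfolding box_def lebn_def using e(1)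
    by (auto intro!: sets_PiM_I_finite simp: lebp.emeasure_PiM)
  show ?thesis
  proof (rule ccontr)
    assume "?f x \<noteq> 0"
    then have "y \<notin> box" if "?f y = 0" for y using same[of y] that by metis
    with ae have "AE y in lebn n. y \<notin> box" by (auto elim: eventually_mono)
    then have "emeasure (lebn n) box = 0" using AE_iff_null_sets[OF box(1)] by auto
    then show False using box(2) e(1) by simp
  qed
qed

definition cone_rep :: "nat list \<Rightarrow> nat \<Rightarrow> (nat \<Rightarrow> real) \<Rightarrow> real" where
  "cone_rep w n = (if n = length w then indicator (word_cone w) else (\<lambda>x. 0))"

lemma graded_fun_cone_rep: "graded_fun (cone_rep w)"
  unfolding cone_rep_def by (intro graded_fun_homogeneous borel_measurable_indicator word_cone_sets)

lemma abs_gradedF_eqI: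
  assumes "graded_fun f" "graded_fun g" "\<And>n x. x \<in> space (lebn n) \<Longrightarrow> f n x = g n x"
  shows "abs_gradedF f = abs_gradedF g"
  using graded_relI[OF assms] by (rule Quotient_rel_abs[OF Quotient_gradedF])

lemma graded_rel_refl: "graded_fun f \<Longrightarrow> graded_rel f f"
  by (simp add: graded_rel_def)

lemma cone_char_abs: "cone_char w = abs_gradedF (cone_rep w)"
  by (simp add: cone_char_def char_fun.abs_eq cone_rep_def[abs_def] word_cone_sets)

lemma cone_char_lincomb:
  assumes "finite W"
  shows "graded_fun (\<lambda>n x. \<Sum>w\<in>W. c w * cone_rep w n x) \<and>
    (\<Sum>w\<in>W. c w *\<^sub>R cone_char w) = abs_gradedF (\<lambda>n x. \<Sum>w\<in>W. c w * cone_rep w n x)"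
  using assms
proof induction
  case empty
  then show ?case by (simp add: graded_fun_zero zero_gradedF.abs_eq)
next
  case (insert w W)
  have g: "graded_fun (\<lambda>n x. c w * cone_rep w n x)" by (rule graded_fun_scale) (rule graded_fun_cone_rep)
  have "c w *\<^sub>R cone_char w = abs_gradedF (\<lambda>n x. c w * cone_rep w n x)"
    unfolding cone_char_abs by (rule scaleR_gradedF.abs_eq) (rule graded_rel_refl, rule graded_fun_cone_rep)
  then show ?case
    using insert graded_fun_add[OF g] g by (simp add: plus_gradedF.abs_eq graded_rel_refl)
qed

text \<open>
  The direct sum lets each length be treated separately. Words of the same length correspond to
  distinct flags, so that the independence of flags applies.
\<close>

lemma cone_chars_independent:
  assumes fin: "finite W" and packed: "W \<subseteq> {w. packed w}"
    and zero: "(\<Sum>w\<in>W. c w *\<^sub>R cone_char w) = 0"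
  shows "\<forall>w\<in>W. c w = 0"
proof
  fix w assume w: "w \<in> W"
  let ?n = "length w"
  define V where "V = {v \<in> W. length v = ?n}"
  define d where "d = (\<lambda>U. c (inv_into V flag_of U))"
  have V: "finite V" "w \<in> V" "\<And>v. v \<in> V \<Longrightarrow> packed v \<and> length v = ?n"
    using fin packed w by (auto simp: V_def)
  have inj: "inj_on flag_of V" using V(3) by (intro inj_onI) (auto intro: flag_of_inj)
  note lc = cone_char_lincomb[OF fin, of c]
  have "graded_rel (\<lambda>n x. \<Sum>w\<in>W. c w * cone_rep w n x) (\<lambda>n x. 0)"
  proof (rule Quotient_rel[OF Quotient_gradedF, THEN iffD1], intro conjI)
    show "abs_gradedF (\<lambda>n x. \<Sum>w\<in>W. c w * cone_rep w n x) = abs_gradedF (\<lambda>n x. 0)"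
      using lc zero by (simp only: zero_gradedF.abs_eq)
  qed (use lc graded_fun_zero in \<open>auto intro: graded_rel_refl\<close>)
  then have "AE x in lebn ?n. (\<Sum>w\<in>W. c w * cone_rep w ?n x) = 0" by (simp add: graded_rel_def)
  moreover have "(\<Sum>w\<in>W. c w * cone_rep w ?n x) =
      (\<Sum>U\<in>flag_of ` V. d U * of_bool (\<forall>S\<in>U. 0 \<le> sum x S))"
    if x: "x \<in> space (lebn ?n)" for x
  proof -
    have "(\<Sum>w\<in>W. c w * cone_rep w ?n x) = (\<Sum>v\<in>V. c v * cone_rep v ?n x)"
      by (rule sum.mono_neutral_right) (use fin in \<open>auto simp: V_def cone_rep_def\<close>)
    also have "\<dots> = (\<Sum>v\<in>V. d (flag_of v) * of_bool (\<forall>S\<in>flag_of v. 0 \<le> sum x S))"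
      using x V(3) inj by (intro sum.cong refl) (simp add: d_def cone_rep_def indicator_def mem_word_cone)
    finally show ?thesis by (simp add: sum.reindex[OF inj])
  qed
  ultimately have ae: "AE x in lebn ?n. (\<Sum>U\<in>flag_of ` V. d U * of_bool (\<forall>S\<in>U. 0 \<le> sum x S)) = 0"
    using AE_space by (auto elim: eventually_elim2)
  have flag: "is_flag U \<and> \<Union>U \<subseteq> {..<?n}" if UV: "U \<in> flag_of ` V" for U
  proof -
    obtain v where v: "v \<in> V" "U = flag_of v" using UV by blast
    have "\<Union>(flag_of v) \<subseteq> {..<length v}" by (auto simp: flag_of_def initial_segment_def)
    with v V(3)[OF v(1)] show ?thesis by (simp add: is_flag_flag_of)
  qed
  have fV: "finite (flag_of ` V)" using V(1) by simp
  have "d (flag_of w) = 0"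
  proof (rule flag_cones_independent[OF fV])
    show "is_flag U" if "U \<in> flag_of ` V" for U using flag[OF that] ..
    show "(\<Sum>U\<in>flag_of ` V. d U * of_bool (\<forall>S\<in>U. 0 \<le> sum x S)) = 0" for x :: "nat \<Rightarrow> real"
      by (rule AE_flag_sum_eq_0_imp[OF fV flag ae])
    show "flag_of w \<in> flag_of ` V" using V(2) by blast
  qed
  then show "c w = 0" using inj V(2) by (simp add: d_def)
qed

lemma nccoeff_lincomb_wqs_M:
  assumes "finite W" "W \<subseteq> {w. packed w}" "packed w"
  shows "nccoeff (\<Sum>v\<in>W. c v *\<^sub>R wqs_M v) w = (if w \<in> W then c w else 0)"
proof -
  have "nccoeff (\<Sum>v\<in>W. c v *\<^sub>R wqs_M v) w = (\<Sum>v\<in>W. if v = w then c v else 0)"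
    unfolding nccoeff_sum
    by (rule sum.cong) (auto simp: scaleR_ncseries.rep_eq wqs_M.rep_eq pack_packed[OF assms(3)])
  then show ?thesis using assms(1) by simp
qed

lemma independent_family:
  fixes f :: "'i \<Rightarrow> 'a::real_vector"
  assumes "\<And>W c. \<lbrakk>finite W; W \<subseteq> P; (\<Sum>w\<in>W. c w *\<^sub>R f w) = 0\<rbrakk> \<Longrightarrow> \<forall>w\<in>W. c w = 0"
  shows "inj_on f P" "independent (f ` P)"
proof -
  show inj: "inj_on f P"
  proof (rule inj_onI, rule ccontr)
    fix u v assume uv: "u \<in> P" "v \<in> P" "f u = f v" "u \<noteq> v"
    have "\<forall>w\<in>{u, v}. (if w = u then 1 else - 1 :: real) = 0"
      by (rule assms) (use uv in auto)
    then show False by simp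
  qed
  show "independent (f ` P)"
    unfolding independent_explicit_finite_subsets
  proof (intro allI impI ballI)
    fix S c b assume S: "S \<subseteq> f ` P" "finite S" and z: "(\<Sum>v\<in>S. c v *\<^sub>R v) = 0" and b: "b \<in> S"
    obtain W where W: "W \<subseteq> P" "S = f ` W" using S(1) by (auto simp: subset_image_iff)
    have injW: "inj_on f W" using inj W(1) by (rule inj_on_subset)
    obtain w where w: "w \<in> W" "b = f w" using b W by blast
    have "\<forall>w\<in>W. c (f w) = 0"
      by (rule assms) (use W S z injW in \<open>auto simp: finite_image_iff sum.reindex\<close>)
    then show "c b = 0" using w by simp
  qed
qed

text \<open>
  The values that \<open>\<alpha>\<close> has to take on the basis; with these signs the structure constants of the two
  algebras agree.
\<close>

definition signed_M :: "nat list \<Rightarrow> ncseries" where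
  "signed_M u = (-1) ^ max_letter u *\<^sub>R wqs_M u"

lemma signed_M_independent:
  assumes "finite W" "W \<subseteq> {w. packed w}" "(\<Sum>w\<in>W. c w *\<^sub>R signed_M w) = 0"
  shows "\<forall>w\<in>W. c w = 0"
proof
  fix w assume w: "w \<in> W"
  have "(\<Sum>v\<in>W. (c v * (-1) ^ max_letter v) *\<^sub>R wqs_M v) = 0"
    using assms(3) by (simp add: signed_M_def)
  then have "c w * (-1) ^ max_letter w = 0"
    using nccoeff_lincomb_wqs_M[OF assms(1,2), of w "\<lambda>v. c v * (-1) ^ max_letter v"] assms(2) w
    by (auto simp: zero_ncseries.rep_eq)
  then show "c w = 0" by simp
qed

lemma span_signed_M: "span (signed_M ` {u. packed u}) = WQSym"
  unfolding WQSym_def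
proof (rule span_eq[THEN iffD2], intro conjI subsetI)
  fix x assume "x \<in> signed_M ` {u. packed u}"
  then obtain u where "packed u" "x = signed_M u" by blast
  then show "x \<in> span (wqs_M ` {u. packed u})"
    by (simp add: signed_M_def span_scale span_base)
next
  fix x assume "x \<in> wqs_M ` {u. packed u}"
  then obtain u where u: "packed u" "x = wqs_M u" by blast
  have "x = (-1) ^ max_letter u *\<^sub>R signed_M u"
    by (simp add: u signed_M_def flip: power_add mult_2)
  then show "x \<in> span (signed_M ` {u. packed u})"
    using u by (simp add: span_scale span_base)
qed

lemma cone_char_mult_eq_char_fun:
  "cone_char u * cone_char v =
    char_fun (length u + length v) (cart_prod (length u) (length v) (word_cone u) (word_cone v))"
proof -
  let ?m = "length u" and ?n = "length v"
  let ?A = "cart_prod ?m ?n (word_cone u) (word_cone v)"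
  have A: "?A \<in> sets (lebn (?m + ?n))" by (intro cart_prod_sets word_cone_sets)
  have "cone_char u * cone_char v = abs_gradedF (star (cone_rep u) (cone_rep v))"
    unfolding cone_char_abs by (rule times_gradedF.abs_eq) (simp_all add: graded_rel_refl graded_fun_cone_rep)
  also have "\<dots> = abs_gradedF (\<lambda>k. if k = ?m + ?n then indicator ?A else (\<lambda>x. 0))"
  proof (rule abs_gradedF_eqI)
    show "graded_fun (star (cone_rep u) (cone_rep v))"
      by (intro graded_fun_star graded_fun_cone_rep)
    show "graded_fun (\<lambda>k. if k = ?m + ?n then indicator ?A else (\<lambda>x. 0))"
      using A by (intro graded_fun_homogeneous) simp
    fix N x assume x: "x \<in> space (lebn N)"
    have "star (cone_rep u) (cone_rep v) N x =
      (\<Sum>k\<le>N. if k = ?m then cone_rep u ?m (front_coords ?m x) * cone_rep v (N - ?m) (back_coords ?m (N - ?m) x) else 0)"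
      unfolding star_def by (rule sum.cong) (auto simp: cone_rep_def)
    also have "\<dots> = (if ?m \<le> N then cone_rep u ?m (front_coords ?m x) * cone_rep v (N - ?m) (back_coords ?m (N - ?m) x) else 0)"
      by simp
    also have "\<dots> = (if N = ?m + ?n then indicator ?A else (\<lambda>x. 0)) x"
      using x by (auto simp: cone_rep_def indicator_def cart_prod_def)
    finally show "star (cone_rep u) (cone_rep v) N x = (if N = ?m + ?n then indicator ?A else (\<lambda>x. 0)) x" .
  qed
  also have "\<dots> = char_fun (?m + ?n) ?A" using A by (simp add: char_fun.abs_eq)
  finally show ?thesis .
qed

lemma cone_char_mult:
  assumes u: "packed u" and v: "packed v"
  shows "cone_char u * cone_char v =
    (\<Sum>w\<in>product_words u v. (-1) ^ (max_letter u + max_letter v + max_letter w) *\<^sub>R cone_char w)"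
proof -
  let ?m = "length u" and ?n = "length v"
  let ?A = "cart_prod ?m ?n (word_cone u) (word_cone v)"
  let ?c = "\<lambda>w. (-1) ^ (max_letter u + max_letter v + max_letter w) :: real"
  have A: "?A \<in> sets (lebn (?m + ?n))" by (intro cart_prod_sets word_cone_sets)
  note lc = cone_char_lincomb[OF finite_product_words, of ?c u v]
  have "char_fun (?m + ?n) ?A = abs_gradedF (\<lambda>k. if k = ?m + ?n then indicator ?A else (\<lambda>x. 0))"
    using A by (simp add: char_fun.abs_eq)
  also have "\<dots> = abs_gradedF (\<lambda>n x. \<Sum>w\<in>product_words u v. ?c w * cone_rep w n x)"
  proof (rule abs_gradedF_eqI)
    show "graded_fun (\<lambda>k. if k = ?m + ?n then indicator ?A else (\<lambda>x. 0))"
      using A by (intro graded_fun_homogeneous) simp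
    show "graded_fun (\<lambda>n x. \<Sum>w\<in>product_words u v. ?c w * cone_rep w n x)" using lc by blast
    fix N x assume x: "x \<in> space (lebn N)"
    show "(if N = ?m + ?n then indicator ?A else (\<lambda>x. 0)) x = (\<Sum>w\<in>product_words u v. ?c w * cone_rep w N x)"
    proof (cases "N = ?m + ?n")
      case True
      then show ?thesis
        using indicator_cart_prod_word_cone[OF u v] x by (simp add: cone_rep_def length_product_words)
    next
      case False
      then show ?thesis by (simp add: cone_rep_def length_product_words)
    qed
  qed
  finally show ?thesis using lc cone_char_mult_eq_char_fun by simp
qed

lemma signed_M_mult:
  "signed_M u * signed_M v =
    (\<Sum>w\<in>product_words u v. (-1) ^ (max_letter u + max_letter v + max_letter w) *\<^sub>R signed_M w)"
proof -
  have "(-1) ^ (max_letter u + max_letter v + max_letter w) *\<^sub>R signed_M w =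
      ((-1) ^ (max_letter u + max_letter v)) *\<^sub>R wqs_M w" for w
    by (simp add: signed_M_def power_add mult.assoc flip: power_mult_distrib)
  then show ?thesis
    by (simp add: signed_M_def wqs_M_mult product_words_def power_add scaleR_sum_right mult.commute)
qed

lemma cone_char_Nil: "cone_char [] = 1"
proof -
  have "word_cone [] = space (lebn 0)" by (simp add: word_cone_def max_letter_def)
  then show ?thesis
    unfolding cone_char_abs one_gradedF.abs_eq
    by (intro abs_gradedF_eqI graded_fun_cone_rep graded_fun_homogeneous) (auto simp: cone_rep_def)
qed

lemma signed_M_Nil: "signed_M [] = 1"
proof -
  have "nccoeff (wqs_M []) = nccoeff 1"
    by (auto simp: wqs_M.rep_eq one_ncseries.rep_eq pack_def)
  then show ?thesis by (simp add: signed_M_def max_letter_def nccoeff_inject)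
qed

lemma packed_Nil: "packed []"
  by (auto simp: packed_def intro: exI[of _ 0])

lemma mult_mem_span:
  fixes B :: "'a::real_algebra_1 set"
  assumes B: "\<And>a b. a \<in> B \<Longrightarrow> b \<in> B \<Longrightarrow> a * b \<in> span B"
    and x: "x \<in> span B" and y: "y \<in> span B"
  shows "x * y \<in> span B"
proof -
  have left: "a * y \<in> span B" if a: "a \<in> B" for a
    using y
    by (induction rule: span_induct_alt) (use a B in \<open>auto simp: distrib_left span_zero intro!: span_add span_scale\<close>)
  show ?thesis
    using x
    by (induction rule: span_induct_alt) (use left in \<open>auto simp: distrib_right span_zero intro!: span_add span_scale\<close>)
qed

lemma linear_mult_on_span:
  fixes f :: "'a::real_algebra_1 \<Rightarrow> 'b::real_algebra_1"
  assumes f: "linear f" and B: "\<And>a b. a \<in> B \<Longrightarrow> b \<in> B \<Longrightarrow> f (a * b) = f a * f b"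
    and x: "x \<in> span B" and y: "y \<in> span B"
  shows "f (x * y) = f x * f y"
proof -
  note lin = linear_add[OF f] linear_scale[OF f] linear_0[OF f]
  have left: "f (a * y) = f a * f y" if a: "a \<in> B" for a
    using y by (induction rule: span_induct_alt) (use a B in \<open>auto simp: distrib_left lin\<close>)
  show ?thesis
    using x by (induction rule: span_induct_alt) (use left in \<open>auto simp: distrib_right lin\<close>)
qed

lemma cone_algebra_span: "cone_algebra = span (cone_char ` {u. packed u})" (is "_ = span ?B")
proof
  have "subalgebra (span ?B)"
    unfolding subalgebra_def
  proof (intro conjI ballI)
    show "subspace (span ?B)" by (rule subspace_span)
    show "1 \<in> span ?B"
      unfolding cone_char_Nil[symmetric] by (rule span_base) (simp add: packed_Nil)
    have "a * b \<in> span ?B" if ab: "a \<in> ?B" "b \<in> ?B" for a b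
    proof -
      obtain u v where "packed u" "packed v" "a = cone_char u" "b = cone_char v"
        using ab by blast
      then show ?thesis
        by (simp add: cone_char_mult packed_product_words span_sum span_scale span_base)
    qed
    then show "x * y \<in> span ?B" if "x \<in> span ?B" "y \<in> span ?B" for x y
      using that by (rule mult_mem_span)
  qed
  then show "cone_algebra \<subseteq> span ?B"
    unfolding cone_algebra_def generated_subalgebra_def by (intro hull_minimal span_superset)
  show "span ?B \<subseteq> cone_algebra"
    unfolding cone_algebra_def generated_subalgebra_def hull_def
    by (auto simp: subalgebra_def intro: subsetD[OF span_minimal])
qed

lemma linear_map_on_span_eq:
  assumes g: "linear_map_on (span B) C g" and h: "linear_map_on (span B) C h"
    and eq: "\<And>b. b \<in> B \<Longrightarrow> g b = h b" and x: "x \<in> span B"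
  shows "g x = h x"
proof -
  have zero: "k 0 = 0" if "linear_map_on (span B) C k" for k
  proof -
    have "k (0 *\<^sub>R 0) = 0 *\<^sub>R k 0" using that span_zero unfolding linear_map_on_def by blast
    then show ?thesis by simp
  qed
  have "x \<in> span B \<and> g x = h x"
    using x
  proof (induction rule: span_induct_alt)
    case base
    show ?case using zero[OF g] zero[OF h] by (simp add: span_zero)
  next
    case (step c b y)
    have b: "b \<in> span B" "c *\<^sub>R b \<in> span B" using step by (auto intro: span_base span_scale)
    have comb: "k (c *\<^sub>R b + y) = c *\<^sub>R k b + k y" if "linear_map_on (span B) C k" for k
      using that b step unfolding linear_map_on_def by simp
    show ?case using comb[OF g] comb[OF h] eq[of b] step b by (simp add: span_add)
  qed
  then show ?thesis ..
qed

text \<open>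
  The linear extension of a bijection between bases is a linear isomorphism. It is multiplicative
  because \<open>cone_char_mult\<close> and \<open>signed_M_mult\<close> have the same coefficients.
\<close>

lemma cone_algebra_iso_WQSym:
  "\<exists>\<alpha>. (\<forall>u. packed u \<longrightarrow> \<alpha> (cone_char u) = signed_M u) \<and> algebra_iso_on cone_algebra WQSym \<alpha>"
proof -
  let ?P = "{u. packed u}"
  let ?B = "cone_char ` ?P"
  have inj: "inj_on cone_char ?P" and indep: "independent ?B"
    by (rule independent_family; rule cone_chars_independent; assumption)+
  have injM: "inj_on signed_M ?P" and indepM: "independent (signed_M ` ?P)"
    by (rule independent_family; rule signed_M_independent; assumption)+
  from linear_independent_extend[OF indep, of "\<lambda>b. signed_M (inv_into ?P cone_char b)"]
  obtain \<alpha> where lin: "linear \<alpha>" and a: "\<And>b. b \<in> ?B \<Longrightarrow> \<alpha> b = signed_M (inv_into ?P cone_char b)"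
    by blast
  have \<alpha>: "\<alpha> (cone_char u) = signed_M u" if "packed u" for u
    using a[of "cone_char u"] that inj by simp
  have im: "\<alpha> ` ?B = signed_M ` ?P" using \<alpha> by (auto simp: image_image)
  have image: "\<alpha> ` cone_algebra = WQSym"
    unfolding cone_algebra_span linear_span_image[OF lin, symmetric] im by (rule span_signed_M)
  have "inj_on \<alpha> ?B" using \<alpha> injM by (auto simp: inj_on_def)
  then have "inj_on \<alpha> cone_algebra"
    unfolding cone_algebra_span using linear_inj_on_span_iff_independent_image[OF lin] indepM im by simp
  with image have bij: "bij_betw \<alpha> cone_algebra WQSym" by (simp add: bij_betw_def)
  have linon: "linear_map_on cone_algebra WQSym \<alpha>"
    unfolding linear_map_on_def using image lin by (auto simp: linear_add linear_scale)
  have mult: "\<alpha> (x * y) = \<alpha> x * \<alpha> y" if "x \<in> cone_algebra" "y \<in> cone_algebra" for x y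
  proof (rule linear_mult_on_span[OF lin])
    show "x \<in> span ?B" "y \<in> span ?B" using that by (simp_all add: cone_algebra_span)
    fix a b assume "a \<in> ?B" "b \<in> ?B"
    then obtain u v where uv: "packed u" "packed v" "a = cone_char u" "b = cone_char v" by blast
    show "\<alpha> (a * b) = \<alpha> a * \<alpha> b"
      using uv by (simp add: cone_char_mult signed_M_mult \<alpha> linear_sum[OF lin] linear_scale[OF lin]
          packed_product_words cong: sum.cong)
  qed
  have "\<alpha> 1 = 1" using \<alpha>[OF packed_Nil] by (simp add: cone_char_Nil signed_M_Nil)
  with linon bij mult have "algebra_iso_on cone_algebra WQSym \<alpha>" by (simp add: algebra_iso_on_def)
  with \<alpha> show ?thesis by blast
qed

theorem theorem5p2:
  shows "(\<exists>\<alpha>. linear_map_on cone_algebra WQSym \<alpha> \<and>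
            (\<forall>u. packed u \<longrightarrow> \<alpha> (cone_char u) = (-1) ^ max_letter u *\<^sub>R wqs_M u) \<and>
            (\<forall>\<beta>. linear_map_on cone_algebra WQSym \<beta> \<and>
                 (\<forall>u. packed u \<longrightarrow> \<beta> (cone_char u) = (-1) ^ max_letter u *\<^sub>R wqs_M u) \<longrightarrow>
                 (\<forall>f\<in>cone_algebra. \<beta> f = \<alpha> f)) \<and>
            algebra_iso_on cone_algebra WQSym \<alpha>) \<and>
         (\<forall>u v. \<forall>c :: nat list \<Rightarrow> real. packed u \<longrightarrow> packed v \<longrightarrow>
            finite {w. packed w \<and> c w \<noteq> 0} \<longrightarrow>
            wqs_M u * wqs_M v = (\<Sum>w | packed w \<and> c w \<noteq> 0. c w *\<^sub>R wqs_M w) \<longrightarrow>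
            char_fun (length u + length v) (cart_prod (length u) (length v) (word_cone u) (word_cone v)) =
              (\<Sum>w | packed w \<and> c w \<noteq> 0.
                 ((-1) powi (int (max_letter u) + int (max_letter v) - int (max_letter w)) * c w)
                   *\<^sub>R cone_char w))"
proof (intro conjI allI impI)
  obtain \<alpha> where \<alpha>: "\<forall>u. packed u \<longrightarrow> \<alpha> (cone_char u) = signed_M u"
    "algebra_iso_on cone_algebra WQSym \<alpha>"
    using cone_algebra_iso_WQSym by blast
  then have lin: "linear_map_on cone_algebra WQSym \<alpha>" by (simp add: algebra_iso_on_def)
  have "\<beta> f = \<alpha> f" if "linear_map_on cone_algebra WQSym \<beta>"
    "\<forall>u. packed u \<longrightarrow> \<beta> (cone_char u) = (-1) ^ max_letter u *\<^sub>R wqs_M u" "f \<in> cone_algebra" for \<beta> f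
    by (rule linear_map_on_span_eq[of "cone_char ` {u. packed u}" WQSym])
      (use that \<alpha>(1) lin in \<open>auto simp: cone_algebra_span signed_M_def\<close>)
  with \<alpha> lin show "\<exists>\<alpha>. linear_map_on cone_algebra WQSym \<alpha> \<and>
            (\<forall>u. packed u \<longrightarrow> \<alpha> (cone_char u) = (-1) ^ max_letter u *\<^sub>R wqs_M u) \<and>
            (\<forall>\<beta>. linear_map_on cone_algebra WQSym \<beta> \<and>
                 (\<forall>u. packed u \<longrightarrow> \<beta> (cone_char u) = (-1) ^ max_letter u *\<^sub>R wqs_M u) \<longrightarrow>
                 (\<forall>f\<in>cone_algebra. \<beta> f = \<alpha> f)) \<and>
            algebra_iso_on cone_algebra WQSym \<alpha>"
    unfolding signed_M_def by blast
next
  fix u v and c :: "nat list \<Rightarrow> real"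
  assume uv: "packed u" "packed v" and fin: "finite {w. packed w \<and> c w \<noteq> 0}"
    and eq: "wqs_M u * wqs_M v = (\<Sum>w | packed w \<and> c w \<noteq> 0. c w *\<^sub>R wqs_M w)"
  \<comment> \<open>The \<open>M\<^sub>w\<close> are linearly independent, so the given expansion of the product is the standard one.\<close>
  have c: "c w = (if w \<in> product_words u v then 1 else 0)" if w: "packed w" for w
  proof -
    have "wqs_M u * wqs_M v = (\<Sum>w\<in>product_words u v. 1 *\<^sub>R wqs_M w)"
      by (simp add: wqs_M_mult product_words_def)
    then have "nccoeff (\<Sum>w | packed w \<and> c w \<noteq> 0. c w *\<^sub>R wqs_M w) w =
        nccoeff (\<Sum>w\<in>product_words u v. 1 *\<^sub>R wqs_M w) w"
      using eq by simp
    then show ?thesis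
      using w fin by (subst (asm) (1 2) nccoeff_lincomb_wqs_M)
        (auto simp: finite_product_words packed_product_words split: if_splits)
  qed
  have "{w. packed w \<and> c w \<noteq> 0} = product_words u v"
    using c packed_product_words by (auto split: if_splits)
  moreover have "(-1) powi (int (max_letter u) + int (max_letter v) - int (max_letter w)) * c w =
      (-1) ^ (max_letter u + max_letter v + max_letter w)" if w: "w \<in> product_words u v" for w
  proof -
    have "(-1 :: real) powi (int (max_letter u) + int (max_letter v) - int (max_letter w)) =
        (-1) ^ (max_letter u + max_letter v) / (-1) ^ max_letter w"
      by (simp add: power_int_diff flip: of_nat_add)
    also have "\<dots> = (-1) ^ (max_letter u + max_letter v + max_letter w)"
      by (cases "even (max_letter w)") (simp_all add: power_add)
    finally show ?thesis using c[OF packed_product_words[OF w]] w by simp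
  qed
  ultimately show "char_fun (length u + length v) (cart_prod (length u) (length v) (word_cone u) (word_cone v)) =
      (\<Sum>w | packed w \<and> c w \<noteq> 0.
         ((-1) powi (int (max_letter u) + int (max_letter v) - int (max_letter w)) * c w) *\<^sub>R cone_char w)"
    using cone_char_mult[OF uv] cone_char_mult_eq_char_fun[of u v] by simp
qed

end
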